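(* Let $\mathfrak{B}$ be a tightly $\sigma$-filtered Boolean algebra and let $\mathfrak{K}$ be its Stone space. Suppose that the Boolean algebra $\mathcal{P}(\omega)/\mathrm{fin}$ contains an $\omega_2$-chain. Then $\ell_\infty$ is not isomorphic to a subspace of $C(\mathfrak{K})$.
   Context: All embeddings of Boolean algebras are injective homomorphisms. For a subset $X$ of a Boolean algebra, $\langle X\rangle$ is the subalgebra generated by $X$. Two subalgebras $A,S$ of a Boolean algebra commute if whenever $a\in A$, $s\in S$ and $a\wedge s=0$, there exist $b_1,b_2\in A\cap S$ with $a\le b_1$, $s\le b_2$, $b_1\wedge b_2=0$. A square of inclusions $R\subseteq A\subseteq B$, $R\subseteq S\subseteq B$ is a push-out diagram if $\langle A\cup S\rangle=B$, $A\cap S=R$, and $A$ and $S$ commute. A Boolean algebra $\mathfrak{B}$ is tightly $\sigma$-filtered if there is an increasing chain of subalgebras $(B_\alpha)_{\alpha<\xi}$ indexed by an ordinal $\xi$ with: $B_0=\{0,1\}$; $\mathfrak{B}=\bigcup_{\alpha<\xi}B_\alpha$; $B_\alpha=\bigcup_{\beta<\alpha}B_\beta$ for limit $\alpha$; and for every $\alpha<\xi$ there are countable subalgebras $R_\alpha,S_\alpha\subseteq\mathfrak{B}$ such that the inclusions $R_\alpha\subseteq B_\alpha\subseteq B_{\alpha+1}$, $R_\alpha\subseteq S_\alpha\subseteq B_{\alpha+1}$ form a push-out diagram. $C(\mathfrak{K})$ is the Banach space of continuous real-valued functions on $\mathfrak{K}$ with the sup norm. An $\omega_2$-chain in $\mathcal{P}(\omega)/\mathrm{fin}$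 is a strictly increasing sequence of length $\omega_2$ there. *)

theory Defs
  imports "HOL-Analysis.Analysis"
begin

text \<open>The Boolean algebra is the whole of a type of class boolean_algebra.\<close>

definition subalgebra :: "'a::boolean_algebra set \<Rightarrow> bool" where
  "subalgebra C \<longleftrightarrow> bot \<in> C \<and> top \<in> C \<and>
     (\<forall>a\<in>C. \<forall>b\<in>C. inf a b \<in> C \<and> sup a b \<in> C) \<and> (\<forall>a\<in>C. - a \<in> C)"

definition generated :: "'a::boolean_algebra set \<Rightarrow> 'a set" where
  "generated X = \<Inter>{C. subalgebra C \<and> X \<subseteq> C}"

definition commute :: "'a::boolean_algebra set \<Rightarrow> 'a set \<Rightarrow> bool" where
  "commute A S \<longleftrightarrow> (\<forall>a\<in>A. \<forall>s\<in>S. inf a s = bot \<longrightarrow>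
     (\<exists>b1\<in>A \<inter> S. \<exists>b2\<in>A \<inter> S. a \<le> b1 \<and> s \<le> b2 \<and> inf b1 b2 = bot))"

definition pushout :: "'a::boolean_algebra set \<Rightarrow> 'a set \<Rightarrow> 'a set \<Rightarrow> 'a set \<Rightarrow> bool" where
  "pushout R A S B \<longleftrightarrow> R \<subseteq> A \<and> A \<subseteq> B \<and> R \<subseteq> S \<and> S \<subseteq> B \<and>
     generated (A \<union> S) = B \<and> A \<inter> S = R \<and> commute A S"

text \<open>The ordinal \<xi> is represented by a well-order W on its field; beta is the
  immediate successor of alpha in W.\<close>
definition is_succ :: "'i rel \<Rightarrow> 'i \<Rightarrow> 'i \<Rightarrow> bool" where
  "is_succ W \<alpha> \<beta> \<longleftrightarrow> \<beta> \<in> Field W \<and> \<alpha> \<in> underS W \<beta> \<and>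
     (\<forall>\<gamma>. \<alpha> \<in> underS W \<gamma> \<longrightarrow> (\<beta>, \<gamma>) \<in> W)"

definition is_least :: "'i rel \<Rightarrow> 'i \<Rightarrow> bool" where
  "is_least W \<alpha> \<longleftrightarrow> \<alpha> \<in> Field W \<and> (\<forall>\<beta>\<in>Field W. (\<alpha>, \<beta>) \<in> W)"

definition is_limit :: "'i rel \<Rightarrow> 'i \<Rightarrow> bool" where
  "is_limit W \<alpha> \<longleftrightarrow> \<alpha> \<in> Field W \<and> \<not> is_least W \<alpha> \<and> \<not> (\<exists>\<beta>. is_succ W \<beta> \<alpha>)"

text \<open>B_(alpha+1); when alpha+1 = xi (alpha last) we use the union, i.e. the whole algebra.\<close>
definition next_stage :: "'i rel \<Rightarrow> ('i \<Rightarrow> 'a set) \<Rightarrow> 'i \<Rightarrow> 'a set" where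
  "next_stage W B \<alpha> = (if \<exists>\<beta>. is_succ W \<alpha> \<beta> then B (THE \<beta>. is_succ W \<alpha> \<beta>) else UNIV)"

definition tightly_sigma_filtration :: "'i rel \<Rightarrow> ('i \<Rightarrow> 'a::boolean_algebra set) \<Rightarrow> bool" where
  "tightly_sigma_filtration W B \<longleftrightarrow>
     Well_order W \<and>
     (\<forall>\<alpha>\<in>Field W. subalgebra (B \<alpha>)) \<and>
     (\<forall>\<alpha> \<beta>. (\<alpha>, \<beta>) \<in> W \<longrightarrow> B \<alpha> \<subseteq> B \<beta>) \<and>
     (\<forall>\<alpha>. is_least W \<alpha> \<longrightarrow> B \<alpha> = {bot, top}) \<and>
     (\<Union>\<alpha>\<in>Field W. B \<alpha>) = UNIV \<and>
     (\<forall>\<alpha>. is_limit W \<alpha> \<longrightarrow> B \<alpha> = (\<Union>\<beta>\<in>underS W \<alpha>. B \<beta>)) \<and>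
     (\<forall>\<alpha>\<in>Field W. \<exists>R S. countable R \<and> countable S \<and> subalgebra R \<and> subalgebra S \<and>
        pushout R (B \<alpha>) S (next_stage W B \<alpha>))"

definition tightly_sigma_filtered :: "'i itself \<Rightarrow> 'a::boolean_algebra itself \<Rightarrow> bool" where
  "tightly_sigma_filtered _ _ \<longleftrightarrow> (\<exists>(W::'i rel) (B::'i \<Rightarrow> 'a set). tightly_sigma_filtration W B)"

definition ultrafilters :: "'a::boolean_algebra set set" where
  "ultrafilters = {U. top \<in> U \<and> bot \<notin> U \<and>
      (\<forall>a\<in>U. \<forall>b. a \<le> b \<longrightarrow> b \<in> U) \<and> (\<forall>a\<in>U. \<forall>b\<in>U. inf a b \<in> U) \<and>
      (\<forall>a. a \<in> U \<or> - a \<in> U)}"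

definition stone_space :: "'a::boolean_algebra set topology" where
  "stone_space = topology_generated_by {{U\<in>ultrafilters. a \<in> U} | a. True}"

definition linfty :: "(nat \<Rightarrow> real) set" where
  "linfty = {x. bounded (range x)}"

definition linfty_norm :: "(nat \<Rightarrow> real) \<Rightarrow> real" where
  "linfty_norm x = (SUP n. \<bar>x n\<bar>)"

definition CK :: "'p topology \<Rightarrow> ('p \<Rightarrow> real) set" where
  "CK K = {f. continuous_map K euclideanreal f}"

definition CK_norm :: "'p topology \<Rightarrow> ('p \<Rightarrow> real) \<Rightarrow> real" where
  "CK_norm K f = (SUP p\<in>topspace K. \<bar>f p\<bar>)"

definition linfty_embeds_in_CK :: "'p topology \<Rightarrow> bool" where
  "linfty_embeds_in_CK K \<longleftrightarrow> (\<exists>T :: (nat \<Rightarrow> real) \<Rightarrow> 'p \<Rightarrow> real.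
     (\<forall>x\<in>linfty. T x \<in> CK K) \<and>
     (\<forall>x\<in>linfty. \<forall>y\<in>linfty. \<forall>p\<in>topspace K. T (\<lambda>n. x n + y n) p = T x p + T y p) \<and>
     (\<forall>x\<in>linfty. \<forall>c. \<forall>p\<in>topspace K. T (\<lambda>n. c * x n) p = c * T x p) \<and>
     (\<exists>c C. 0 < c \<and> (\<forall>x\<in>linfty.
        c * linfty_norm x \<le> CK_norm K (T x) \<and> CK_norm K (T x) \<le> C * linfty_norm x)))"

definition le_aleph1 :: "'c set \<Rightarrow> bool" where
  "le_aleph1 S \<longleftrightarrow> (\<exists>V. Well_order V \<and> Field V = S \<and> (\<forall>x\<in>S. countable (underS V x)))"

definition omega2_order :: "'c rel \<Rightarrow> bool" where
  "omega2_order W \<longleftrightarrow> Well_order W \<and> (\<forall>x\<in>Field W. le_aleph1 (underS W x)) \<and> \<not> le_aleph1 (Field W)"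

text \<open>Order of P(omega)/fin on representatives: [A] \<le> [B] iff A - B is finite.\<close>
definition pfin_less :: "nat set \<Rightarrow> nat set \<Rightarrow> bool" where
  "pfin_less A B \<longleftrightarrow> finite (A - B) \<and> infinite (B - A)"

definition has_omega2_chain :: "'c itself \<Rightarrow> bool" where
  "has_omega2_chain _ \<longleftrightarrow> (\<exists>(W::'c rel) (f::'c \<Rightarrow> nat set). omega2_order W \<and>
     (\<forall>x\<in>Field W. \<forall>y\<in>Field W. x \<in> underS W y \<longrightarrow> pfin_less (f x) (f y)))"

end

theory Submission
  imports Defs
begin

text \<open>
  A tightly \<open>\<sigma>\<close>-filtered algebra has the weak Freese--Nation property: there are countable sets
  \<open>g x\<close> such that \<open>x \<le> y\<close> always factors through an element of \<open>g x \<inter> g y\<close>.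

  Given an embedding \<open>T\<close> of \<open>\<ell>\<^sub>\<infinity>\<close> into \<open>C(K)\<close>, Partington's theorem lets us assume that it is almost
  isometric. Then \<open>\<phi> A = T 1\<^sub>A\<close> is almost monotone where it is close to its maximum, so there are
  clopen sets \<open>b A\<close>, \<open>c A\<close> and points \<open>p n\<close> with \<open>b A \<le> c A'\<close> for \<open>A \<subseteq> A'\<close>, with \<open>p n\<close> in \<open>b A\<close> for
  \<open>n \<in> A\<close>, and with \<open>p n\<close> outside \<open>c A\<close> for \<open>n \<notin> A\<close>.

  Let \<open>(f x)\<close> be an \<open>\<omega>\<^sub>2\<close>-chain and \<open>\<delta>\<close> an upper bound of a suitably closed \<open>\<omega>\<^sub>1\<close>-sequence \<open>(e i)\<close>
  of indices. Each \<open>b (f (e i))\<close> lies below some \<open>c (f \<delta> \<union> F)\<close> with \<open>F\<close> finite, so it does so through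
  an element of a fixed countable set. One such element \<open>d\<close> serves uncountably many \<open>i\<close>; the set
  \<open>{n. d \<in> p n}\<close> then almost contains every \<open>f x\<close>, by closure of the sequence, but is almost
  contained in \<open>f \<delta>\<close>.
\<close>

section \<open>The weak Freese--Nation property\<close>

lemma subalgebra_generated: "subalgebra (generated X)"
  unfolding subalgebra_def generated_def by auto

lemma generated_superset: "X \<subseteq> generated X"
  unfolding generated_def by auto

lemma generated_least: "subalgebra C \<Longrightarrow> X \<subseteq> C \<Longrightarrow> generated X \<subseteq> C"
  unfolding generated_def by auto

lemma generated_mono: "X \<subseteq> Y \<Longrightarrow> generated X \<subseteq> generated Y"
  unfolding generated_def by auto

lemma generated_idem: "X \<subseteq> generated Y \<Longrightarrow> generated X \<subseteq> generated Y"
  by (rule generated_least[OF subalgebra_generated])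

lemma subalgebra_trivial: "subalgebra {bot, top}"
  unfolding subalgebra_def by auto

lemma subalgebra_closed:
  assumes "subalgebra C"
  shows "bot \<in> C" "top \<in> C" "a \<in> C \<Longrightarrow> b \<in> C \<Longrightarrow> inf a b \<in> C"
    "a \<in> C \<Longrightarrow> b \<in> C \<Longrightarrow> sup a b \<in> C" "a \<in> C \<Longrightarrow> - a \<in> C"
  using assms unfolding subalgebra_def by auto

lemmas generated_closed = subalgebra_closed[OF subalgebra_generated]

lemma countable_generated:
  assumes "countable X"
  shows "countable (generated X)"
proof -
  define step where "step = (\<lambda>Y::'a set. Y \<union> (\<lambda>(a, b). inf a b) ` (Y \<times> Y)
    \<union> (\<lambda>(a, b). sup a b) ` (Y \<times> Y) \<union> uminus ` Y)"
  define F where "F = (\<lambda>n. (step ^^ n) (X \<union> {bot, top}))"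
  have F_Suc: "F (Suc n) = step (F n)" for n
    by (simp add: F_def)
  have mono: "F m \<subseteq> F n" if "m \<le> n" for m n
    using that by (rule lift_Suc_mono_le[rotated]) (auto simp: F_Suc step_def)
  have count: "countable (F n)" for n
  proof (induction n)
    case 0
    then show ?case using assms by (simp add: F_def)
  next
    case (Suc n)
    then show ?case by (auto simp: F_Suc step_def)
  qed
  have up: "a \<in> (\<Union>n. F n) \<Longrightarrow> b \<in> (\<Union>n. F n) \<Longrightarrow> \<exists>n. a \<in> F n \<and> b \<in> F n" for a b
  proof -
    assume "a \<in> (\<Union>n. F n)" "b \<in> (\<Union>n. F n)"
    then obtain m n where "a \<in> F m" "b \<in> F n" by auto
    then have "a \<in> F (max m n)" "b \<in> F (max m n)"
      using mono[of m "max m n"] mono[of n "max m n"] by auto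
    then show ?thesis by blast
  qed
  have ops: "inf a b \<in> (\<Union>n. F n) \<and> sup a b \<in> (\<Union>n. F n) \<and> - a \<in> (\<Union>n. F n)"
    if ab: "a \<in> (\<Union>n. F n)" "b \<in> (\<Union>n. F n)" for a b
  proof -
    obtain n where "a \<in> F n" "b \<in> F n" using up[OF ab] by auto
    then have "inf a b \<in> F (Suc n) \<and> sup a b \<in> F (Suc n) \<and> - a \<in> F (Suc n)"
      unfolding F_Suc step_def by blast
    then show ?thesis by blast
  qed
  have F0: "X \<union> {bot, top} \<subseteq> (\<Union>n. F n)"
    by (rule order_trans[OF _ UN_upper[of 0]]) (simp_all add: F_def)
  then have "subalgebra (\<Union>n. F n)"
    unfolding subalgebra_def using ops by simp
  then have "generated X \<subseteq> (\<Union>n. F n)"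
    using F0 by (intro generated_least) auto
  then show ?thesis
    using count by (rule countable_subset[OF _ countable_UN[OF countableI_type]])
qed

text \<open>The elements generated by finitely many of the pieces \<open>S \<beta>\<close> already
  form a subalgebra, because two finite supports can be united.\<close>

lemma generated_UN_finite_support:
  assumes "x \<in> generated (\<Union>\<beta>\<in>\<Gamma>. S \<beta>)"
  shows "\<exists>F. finite F \<and> F \<subseteq> \<Gamma> \<and> x \<in> generated (\<Union>\<beta>\<in>F. S \<beta>)"
proof -
  let ?C = "{x. \<exists>F. finite F \<and> F \<subseteq> \<Gamma> \<and> x \<in> generated (\<Union>\<beta>\<in>F. S \<beta>)}"
  have both: "inf a b \<in> ?C \<and> sup a b \<in> ?C" if "a \<in> ?C" "b \<in> ?C" for a b
  proof -
    from that obtain F F' where F: "finite F" "F \<subseteq> \<Gamma>" "a \<in> generated (\<Union>\<beta>\<in>F. S \<beta>)"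
      "finite F'" "F' \<subseteq> \<Gamma>" "b \<in> generated (\<Union>\<beta>\<in>F'. S \<beta>)" by auto
    have "a \<in> generated (\<Union>\<beta>\<in>F \<union> F'. S \<beta>)" "b \<in> generated (\<Union>\<beta>\<in>F \<union> F'. S \<beta>)"
      using F generated_mono[of "\<Union>\<beta>\<in>F. S \<beta>" "\<Union>\<beta>\<in>F \<union> F'. S \<beta>"]
        generated_mono[of "\<Union>\<beta>\<in>F'. S \<beta>" "\<Union>\<beta>\<in>F \<union> F'. S \<beta>"] by auto
    then have "inf a b \<in> generated (\<Union>\<beta>\<in>F \<union> F'. S \<beta>)" "sup a b \<in> generated (\<Union>\<beta>\<in>F \<union> F'. S \<beta>)"
      by (simp_all add: generated_closed)
    moreover have "finite (F \<union> F')" "F \<union> F' \<subseteq> \<Gamma>" using F by auto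
    ultimately show ?thesis by blast
  qed
  have "finite {}" "{} \<subseteq> \<Gamma>" by auto
  then have "bot \<in> ?C" "top \<in> ?C" using generated_closed(1,2) by blast+
  moreover have "- a \<in> ?C" if "a \<in> ?C" for a
    using that by (auto intro: generated_closed(5))
  ultimately have "subalgebra ?C"
    using both unfolding subalgebra_def by simp
  moreover have "(\<Union>\<beta>\<in>\<Gamma>. S \<beta>) \<subseteq> ?C"
  proof
    fix x assume "x \<in> (\<Union>\<beta>\<in>\<Gamma>. S \<beta>)"
    then obtain \<beta> where "\<beta> \<in> \<Gamma>" "x \<in> S \<beta>" by auto
    then have "finite {\<beta>}" "{\<beta>} \<subseteq> \<Gamma>" "x \<in> generated (\<Union>\<beta>\<in>{\<beta>}. S \<beta>)"
      using generated_superset[of "S \<beta>"] by auto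
    then show "x \<in> ?C" by blast
  qed
  ultimately have "generated (\<Union>\<beta>\<in>\<Gamma>. S \<beta>) \<subseteq> ?C" by (rule generated_least)
  then show ?thesis using assms by auto
qed

section \<open>Finite joins of meets, and interpolation between them\<close>

inductive_set joins :: "'a::boolean_algebra set \<Rightarrow> 'a set \<Rightarrow> 'a set" for A S where
  joins_meet: "a \<in> A \<Longrightarrow> s \<in> S \<Longrightarrow> inf a s \<in> joins A S"
| joins_sup: "x \<in> joins A S \<Longrightarrow> y \<in> joins A S \<Longrightarrow> sup x y \<in> joins A S"

lemma joins_inf:
  assumes A: "subalgebra A" and S: "subalgebra S"
    and x: "x \<in> joins A S" and y: "y \<in> joins A S"
  shows "inf x y \<in> joins A S"
  using x
proof (induction x)
  case (joins_meet a s)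
  show ?case
    using y
  proof (induction y)
    case (joins_meet a' s')
    have "inf (inf a s) (inf a' s') = inf (inf a a') (inf s s')"
      by (simp add: ac_simps)
    then show ?case
      using joins_meet \<open>a \<in> A\<close> \<open>s \<in> S\<close> A S by (auto intro!: joins.joins_meet simp: subalgebra_closed)
  next
    case (joins_sup x y)
    then show ?case by (simp add: inf_sup_distrib1 joins.joins_sup)
  qed
next
  case (joins_sup x' y')
  then show ?case by (simp add: inf_sup_distrib2 joins.joins_sup)
qed

text \<open>The complement of \<open>inf a s\<close> is the join of \<open>- a\<close> and
  \<open>- s\<close>, and complements of joins become meets, which \<open>joins_inf\<close> handles
  by distributivity. Writing elements this way lets interpolation be checked on single meets
  \<open>inf a s\<close>.\<close>

lemma generated_subset_joins:
  assumes A: "subalgebra A" and S: "subalgebra S"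
  shows "generated (A \<union> S) \<subseteq> joins A S"
proof (rule generated_least)
  have sub: "a \<in> joins A S" if "a \<in> A \<union> S" for a
    using that joins_meet[of a A top S] joins_meet[of top A a S] subalgebra_closed(2)[OF A]
      subalgebra_closed(2)[OF S] by auto
  then show "A \<union> S \<subseteq> joins A S" by blast
  have "- x \<in> joins A S" if "x \<in> joins A S" for x
    using that
  proof (induction x)
    case (joins_meet a s)
    then show ?case
      using subalgebra_closed(5)[OF A] subalgebra_closed(5)[OF S] sub by (auto intro: joins_sup)
  next
    case (joins_sup x y)
    then show ?case using joins_inf[OF A S] by simp
  qed
  then show "subalgebra (joins A S)"
    unfolding subalgebra_def using sub subalgebra_closed(1,2)[OF A] joins_inf[OF A S]
    by (auto intro: joins_sup)
qed

text \<open>Since \<open>y\<close> is a meet of elements \<open>- inf a' s'\<close>, no disjoint normal form is needed.\<close>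

lemma interpolation_from_joins:
  assumes D: "subalgebra D"
    and x: "x \<in> joins A S" and y: "- y \<in> joins A' S'" and le: "x \<le> y"
    and basic: "\<And>a s a' s'. a \<in> A \<Longrightarrow> s \<in> S \<Longrightarrow> a' \<in> A' \<Longrightarrow> s' \<in> S' \<Longrightarrow>
      inf a s \<le> - inf a' s' \<Longrightarrow> \<exists>d\<in>D. inf a s \<le> d \<and> d \<le> - inf a' s'"
  shows "\<exists>d\<in>D. x \<le> d \<and> d \<le> y"
proof -
  have 1: "\<exists>d\<in>D. inf a s \<le> d \<and> d \<le> - z"
    if "z \<in> joins A' S'" "a \<in> A" "s \<in> S" "inf a s \<le> - z" for a s z
    using that
  proof (induction z)
    case (joins_meet a' s')
    then show ?case by (intro basic)
  next
    case (joins_sup z z')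
    then obtain d d' where "d \<in> D" "d' \<in> D" "inf a s \<le> d" "inf a s \<le> d'" "d \<le> - z" "d' \<le> - z'"
      by (metis compl_sup le_inf_iff)
    then show ?case
      by (intro bexI[of _ "inf d d'"])
        (auto simp: D subalgebra_closed intro: le_infI1 le_infI2)
  qed
  have "\<exists>d\<in>D. x \<le> d \<and> d \<le> - (- y)"
    using x le
  proof (induction x)
    case (joins_meet a s)
    then show ?case using 1[OF y] by simp
  next
    case (joins_sup x x')
    then obtain d d' where "d \<in> D" "d' \<in> D" "x \<le> d" "x' \<le> d'" "d \<le> y" "d' \<le> y"
      by auto
    then show ?case
      by (intro bexI[of _ "sup d d'"])
        (auto simp: D subalgebra_closed intro: le_supI1 le_supI2)
  qed
  then show ?thesis by simp
qed

section \<open>Towers of commuting countable subalgebras\<close>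

locale commuting_tower =
  fixes W :: "'i rel" and S :: "'i \<Rightarrow> 'a::boolean_algebra set"
  assumes well_order: "Well_order W"
    and subalgebra_S: "\<alpha> \<in> Field W \<Longrightarrow> subalgebra (S \<alpha>)"
    and countable_S: "\<alpha> \<in> Field W \<Longrightarrow> countable (S \<alpha>)"
    and commute_S: "\<alpha> \<in> Field W \<Longrightarrow> commute (generated (\<Union>\<beta>\<in>underS W \<alpha>. S \<beta>)) (S \<alpha>)"
begin

text \<open>For a filtration, \<open>G (underS W \<alpha>)\<close> is the stage
  \<open>B \<alpha>\<close>. Arbitrary index sets are allowed so that countable ones yield countable
  pieces of the algebra.\<close>

definition G :: "'i set \<Rightarrow> 'a set" where
  "G \<Gamma> = generated (\<Union>\<beta>\<in>\<Gamma>. S \<beta>)"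

text \<open>For closed index sets the pieces interpolate: any inequality between \<open>G \<Gamma>\<close> and \<open>G \<Delta>\<close>
  passes through \<open>G (\<Gamma> \<inter> \<Delta>)\<close>. The condition says that the gluing algebra of \<open>S \<alpha>\<close> with the
  tower below \<open>\<alpha>\<close> is already generated by indices in \<open>\<Gamma>\<close>.\<close>

definition closed_index :: "'i set \<Rightarrow> bool" where
  "closed_index \<Gamma> \<longleftrightarrow> \<Gamma> \<subseteq> Field W \<and> (\<forall>\<alpha>\<in>\<Gamma>. G (underS W \<alpha>) \<inter> S \<alpha> \<subseteq> G (\<Gamma> \<inter> underS W \<alpha>))"

lemma G_mono: "\<Gamma> \<subseteq> \<Delta> \<Longrightarrow> G \<Gamma> \<subseteq> G \<Delta>"
  unfolding G_def by (intro generated_mono) auto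

lemma subalgebra_G: "subalgebra (G \<Gamma>)"
  unfolding G_def by (rule subalgebra_generated)

lemma S_subset_G: "\<alpha> \<in> \<Gamma> \<Longrightarrow> S \<alpha> \<subseteq> G \<Gamma>"
  unfolding G_def by (rule order_trans[OF UN_upper generated_superset])

lemma G_finite_support: "x \<in> G \<Gamma> \<Longrightarrow> \<exists>F. finite F \<and> F \<subseteq> \<Gamma> \<and> x \<in> G F"
  unfolding G_def by (rule generated_UN_finite_support)

lemmas G_closed = subalgebra_closed[OF subalgebra_G]

lemma wf_induct_index [consumes 1]:
  assumes "\<alpha> \<in> Field W"
    and "\<And>\<alpha>. \<alpha> \<in> Field W \<Longrightarrow> (\<And>\<beta>. \<beta> \<in> underS W \<alpha> \<Longrightarrow> P \<beta>) \<Longrightarrow> P \<alpha>"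
  shows "P \<alpha>"
proof -
  have "wf (W - Id)"
    using well_order by (simp add: well_order_on_def)
  then have "\<alpha> \<in> Field W \<longrightarrow> P \<alpha>"
  proof (induction \<alpha>)
    case (less \<alpha>)
    show ?case
    proof
      assume "\<alpha> \<in> Field W"
      then show "P \<alpha>"
      proof (rule assms(2))
        fix \<beta> assume "\<beta> \<in> underS W \<alpha>"
        then have "(\<beta>, \<alpha>) \<in> W - Id" "\<beta> \<in> Field W"
          by (auto simp: underS_def Field_def)
        then show "P \<beta>" using less by blast
      qed
    qed
  qed
  then show ?thesis using assms(1) by blast
qed

lemma finite_index_max:
  assumes "finite F" "F \<noteq> {}" "F \<subseteq> Field W"
  shows "\<exists>m\<in>F. F \<subseteq> under W m"
  using assms
proof (induction F rule: finite_ne_induct)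
  case (singleton x)
  then show ?case
    using well_order by (auto simp: under_def well_order_on_def linear_order_on_def
        partial_order_on_def preorder_on_def refl_on_def)
next
  case (insert x F)
  have W: "Total W" "trans W" "Refl W"
    using well_order by (auto simp: well_order_on_def linear_order_on_def
        partial_order_on_def preorder_on_def)
  obtain m where m: "m \<in> F" "F \<subseteq> under W m" using insert by auto
  have field: "x \<in> Field W" "m \<in> Field W" using insert.prems m(1) by auto
  then have xx: "(x, x) \<in> W" using W(3) by (simp add: refl_on_def)
  moreover have "(x, m) \<in> W \<or> (m, x) \<in> W"
    using W(1) field xx by (cases "x = m") (auto simp: total_on_def)
  moreover have "F \<subseteq> under W x" if "(m, x) \<in> W"
    using that m(2) W(2) by (auto simp: under_def elim: transE)
  ultimately show ?case
    using m by (auto simp: under_def)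
qed

lemma underS_conv_under: "\<alpha> \<in> Field W \<Longrightarrow> under W \<alpha> = insert \<alpha> (underS W \<alpha>)"
  using well_order by (auto simp: under_def underS_def well_order_on_def linear_order_on_def
        partial_order_on_def preorder_on_def refl_on_def)

text \<open>The index \<alpha> is split off from those below it. If \<alpha> lies outside \<Gamma>,
  the trivial algebra stands in for \<open>S \<alpha>\<close>, so that both cases have the same
  shape.\<close>

lemma G_under_subset_joins:
  assumes "\<alpha> \<in> Field W"
  shows "G (\<Gamma> \<inter> under W \<alpha>) \<subseteq>
    joins (G (\<Gamma> \<inter> underS W \<alpha>)) (if \<alpha> \<in> \<Gamma> then S \<alpha> else {bot, top})"
proof -
  let ?S = "if \<alpha> \<in> \<Gamma> then S \<alpha> else {bot, top}"
  have "(\<Union>\<beta>\<in>\<Gamma> \<inter> under W \<alpha>. S \<beta>) \<subseteq> G (\<Gamma> \<inter> underS W \<alpha>) \<union> ?S"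
    using S_subset_G[of _ "\<Gamma> \<inter> underS W \<alpha>"] by (auto simp: underS_conv_under[OF assms])
  then have "G (\<Gamma> \<inter> under W \<alpha>) \<subseteq> generated (G (\<Gamma> \<inter> underS W \<alpha>) \<union> ?S)"
    unfolding G_def by (rule generated_mono)
  also have "\<dots> \<subseteq> joins (G (\<Gamma> \<inter> underS W \<alpha>)) ?S"
    by (rule generated_subset_joins[OF subalgebra_G])
      (simp add: subalgebra_S[OF assms] subalgebra_trivial)
  finally show ?thesis .
qed

text \<open>The second separator \<open>b2\<close> given by commutation serves as \<open>r\<close>:
  it is disjoint from \<open>b1\<close>, hence from \<open>a\<close>. Thus \<open>s\<close> can be
  replaced by an element of the tower below \<alpha>.\<close>

lemma commute_separation:
  assumes "\<alpha> \<in> Field W" "a \<in> G (underS W \<alpha>)" "s \<in> S \<alpha>" "inf a s = bot"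
  shows "\<exists>r\<in>G (underS W \<alpha>) \<inter> S \<alpha>. s \<le> r \<and> inf a r = bot"
proof -
  have "commute (G (underS W \<alpha>)) (S \<alpha>)"
    using commute_S[OF assms(1)] by (simp add: G_def)
  then have "\<exists>b1\<in>G (underS W \<alpha>) \<inter> S \<alpha>. \<exists>b2\<in>G (underS W \<alpha>) \<inter> S \<alpha>. a \<le> b1 \<and> s \<le> b2 \<and> inf b1 b2 = bot"
    using assms(2-4) unfolding commute_def by simp
  then obtain b1 b2 where "b2 \<in> G (underS W \<alpha>) \<inter> S \<alpha>" "a \<le> b1" "s \<le> b2" "inf b1 b2 = bot"
    by (elim bexE conjE)
  moreover have "inf a b2 \<le> inf b1 b2"
    using \<open>a \<le> b1\<close> by (rule inf_mono) simp
  ultimately show ?thesis by (metis bot.extremum_uniqueI)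
qed

text \<open>It suffices to interpolate between \<open>inf a s\<close> and
  \<open>- inf a' s'\<close>. Commutation replaces \<open>inf s s'\<close> by an element
  \<open>r\<close> of the gluing algebra; closedness of \<Gamma> or \<Delta> places \<open>r\<close>
  over indices below \<alpha>, where \<open>IH\<close> applies.\<close>

lemma interpolation_step:
  assumes \<alpha>: "\<alpha> \<in> Field W" and \<Gamma>: "closed_index \<Gamma>" and \<Delta>: "closed_index \<Delta>"
    and IH: "\<And>x y. x \<in> G (\<Gamma> \<inter> underS W \<alpha>) \<Longrightarrow> y \<in> G (\<Delta> \<inter> underS W \<alpha>) \<Longrightarrow> x \<le> y \<Longrightarrow>
      \<exists>d\<in>G (\<Gamma> \<inter> \<Delta>). x \<le> d \<and> d \<le> y"
    and x: "x \<in> G (\<Gamma> \<inter> under W \<alpha>)" and y: "y \<in> G (\<Delta> \<inter> under W \<alpha>)" and le: "x \<le> y"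
  shows "\<exists>d\<in>G (\<Gamma> \<inter> \<Delta>). x \<le> d \<and> d \<le> y"
proof (rule interpolation_from_joins[OF subalgebra_G _ _ le])
  show "x \<in> joins (G (\<Gamma> \<inter> underS W \<alpha>)) (if \<alpha> \<in> \<Gamma> then S \<alpha> else {bot, top})"
    using x G_under_subset_joins[OF \<alpha>] by blast
  show "- y \<in> joins (G (\<Delta> \<inter> underS W \<alpha>)) (if \<alpha> \<in> \<Delta> then S \<alpha> else {bot, top})"
    using G_closed(5)[OF y] G_under_subset_joins[OF \<alpha>] by blast
next
  fix a s a' s'
  assume a: "a \<in> G (\<Gamma> \<inter> underS W \<alpha>)" and s: "s \<in> (if \<alpha> \<in> \<Gamma> then S \<alpha> else {bot, top})"
    and a': "a' \<in> G (\<Delta> \<inter> underS W \<alpha>)" and s': "s' \<in> (if \<alpha> \<in> \<Delta> then S \<alpha> else {bot, top})"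
    and le': "inf a s \<le> - inf a' s'"
  have S\<alpha>: "s \<in> S \<alpha>" "s' \<in> S \<alpha>"
    using s s' subalgebra_closed(1,2)[OF subalgebra_S[OF \<alpha>]] by (auto split: if_splits)
  have sub: "G (\<Gamma> \<inter> underS W \<alpha>) \<subseteq> G (underS W \<alpha>)" "G (\<Delta> \<inter> underS W \<alpha>) \<subseteq> G (underS W \<alpha>)"
    by (auto intro!: G_mono)
  have "inf (inf a a') (inf s s') = inf (inf a s) (inf a' s')"
    by (simp add: ac_simps)
  also have "\<dots> = bot"
    using le' by (simp add: inf_shunt)
  finally obtain r where r: "r \<in> G (underS W \<alpha>) \<inter> S \<alpha>" "inf s s' \<le> r" "inf (inf a a') r = bot"
    using commute_separation[OF \<alpha>, of "inf a a'" "inf s s'"] a a' sub S\<alpha>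
      subalgebra_closed(3)[OF subalgebra_S[OF \<alpha>]] G_closed(3) by blast
  show "\<exists>d\<in>G (\<Gamma> \<inter> \<Delta>). inf a s \<le> d \<and> d \<le> - inf a' s'"
  proof (cases "\<alpha> \<in> \<Gamma>")
    case True
    then have "r \<in> G (\<Gamma> \<inter> underS W \<alpha>)"
      using \<Gamma> r(1) unfolding closed_index_def by blast
    then have "inf a r \<in> G (\<Gamma> \<inter> underS W \<alpha>)" "- a' \<in> G (\<Delta> \<inter> underS W \<alpha>)" "inf a r \<le> - a'"
      using a a' r(3) by (auto simp: G_closed inf_shunt[symmetric] ac_simps)
    then obtain e where e: "e \<in> G (\<Gamma> \<inter> \<Delta>)" "inf a r \<le> e" "e \<le> - a'"
      using IH by blast
    show ?thesis
    proof (cases "\<alpha> \<in> \<Delta>")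
      case True
      have "s \<in> G (\<Gamma> \<inter> \<Delta>)" "s' \<in> G (\<Gamma> \<inter> \<Delta>)"
        using S\<alpha> S_subset_G[of \<alpha> "\<Gamma> \<inter> \<Delta>"] True \<open>\<alpha> \<in> \<Gamma>\<close> by auto
      \<comment> \<open>With \<alpha> in both index sets, \<open>s\<close> and \<open>s'\<close> may
        be used in the interpolant. The part of \<open>inf a s\<close> inside \<open>s'\<close> lies
        below \<open>inf a r\<close> and hence below \<open>e\<close>; the part outside
        \<open>s'\<close> lies below \<open>inf s (- s')\<close>.\<close>
      then have "sup (inf e s) (inf s (- s')) \<in> G (\<Gamma> \<inter> \<Delta>)"
        using e(1) by (simp add: G_closed)
      moreover have "inf a s \<le> sup (inf e s) (inf s (- s'))"
      proof -
        have "inf a s = sup (inf (inf a s) s') (inf (inf a s) (- s'))"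
          by (simp flip: inf_sup_distrib1)
        moreover have "inf (inf a s) s' \<le> inf e s"
        proof -
          have "inf (inf a s) s' \<le> inf a r"
            using r(2) by (metis inf.assoc inf_mono order_refl)
          then show ?thesis
            using e(2) by (meson inf.boundedI inf.cobounded1 inf.cobounded2 order_trans)
        qed
        moreover have "inf (inf a s) (- s') \<le> inf s (- s')"
          by (rule inf_mono) simp_all
        ultimately show ?thesis by (metis sup_mono)
      qed
      moreover have "sup (inf e s) (inf s (- s')) \<le> - inf a' s'"
        using e(3) by (simp add: le_infI1 le_infI2 le_supI1 le_supI2)
      ultimately show ?thesis by blast
    next
      case False
      then consider "s' = bot" | "s' = top" using s' by auto
      then show ?thesis
      proof cases
        case 1
        then show ?thesis using G_closed(2) by (intro bexI[of _ top]) auto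
      next
        case 2
        then have "inf a s \<le> e"
          using r(2) e(2) by (metis inf_mono inf_top_right order_refl order_trans)
        then show ?thesis using e 2 by auto
      qed
    qed
  next
    case False
    then consider "s = bot" | "s = top" using s by auto
    then show ?thesis
    proof cases
      case 1
      then show ?thesis using G_closed(1) by (intro bexI[of _ bot]) auto
    next
      case 2
      show ?thesis
      proof (cases "\<alpha> \<in> \<Delta>")
        case True
        then have "r \<in> G (\<Delta> \<inter> underS W \<alpha>)"
          using \<Delta> r(1) unfolding closed_index_def by blast
        \<comment> \<open>Now only \<Delta> contains \<alpha>, so \<open>r\<close> is available on
          the right-hand side and is met with \<open>a'\<close> instead of \<open>a\<close>.\<close>
        then have "- inf a' r \<in> G (\<Delta> \<inter> underS W \<alpha>)" "a \<le> - inf a' r"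
          using a' r(3) by (auto simp: G_closed inf_shunt[symmetric] ac_simps simp del: compl_inf)
        then obtain e where e: "e \<in> G (\<Gamma> \<inter> \<Delta>)" "a \<le> e" "e \<le> - inf a' r"
          using IH a by blast
        moreover have "- inf a' r \<le> - inf a' s'"
          using r(2) 2 by (simp only: compl_le_compl_iff) (metis inf_mono inf_top_left order_refl)
        ultimately show ?thesis using 2 by (metis inf_top_right order_trans)
      next
        case False
        then consider "s' = bot" | "s' = top" using s' by auto
        then show ?thesis
        proof cases
          case 1
          then show ?thesis using G_closed(2) by (intro bexI[of _ top]) auto
        next
          case 2
          then have "a \<le> - a'" using le' \<open>s = top\<close> by simp
          then show ?thesis
            using IH[OF a G_closed(5)[OF a']] 2 \<open>s = top\<close> by auto
        qed
      qed
    qed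
  qed
qed

text \<open>Well-founded induction on an index \<alpha> bounding the supports of \<open>x\<close>
  and \<open>y\<close>. Supports are finite and so have a largest index; elements supported strictly
  below \<alpha> are therefore bounded by a smaller index, and limits need no separate case.\<close>

lemma interpolation:
  assumes \<Gamma>: "closed_index \<Gamma>" and \<Delta>: "closed_index \<Delta>"
    and x: "x \<in> G \<Gamma>" and y: "y \<in> G \<Delta>" and le: "x \<le> y"
  shows "\<exists>d\<in>G (\<Gamma> \<inter> \<Delta>). x \<le> d \<and> d \<le> y"
proof -
  have reduce: "\<exists>d\<in>G (\<Gamma> \<inter> \<Delta>). x \<le> d \<and> d \<le> y"
    if P: "\<And>\<alpha> x y. \<alpha> \<in> X \<Longrightarrow> x \<in> G (\<Gamma> \<inter> under W \<alpha>) \<Longrightarrow> y \<in> G (\<Delta> \<inter> under W \<alpha>) \<Longrightarrow> x \<le> y \<Longrightarrow>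
        \<exists>d\<in>G (\<Gamma> \<inter> \<Delta>). x \<le> d \<and> d \<le> y"
      and X: "X \<subseteq> Field W" and x: "x \<in> G (\<Gamma> \<inter> X)" and y: "y \<in> G (\<Delta> \<inter> X)" and le: "x \<le> y"
    for X x y
  proof -
    obtain F where F: "finite F" "F \<subseteq> \<Gamma> \<inter> X" "x \<in> G F"
      using G_finite_support[OF x] by (elim exE conjE)
    obtain F' where F': "finite F'" "F' \<subseteq> \<Delta> \<inter> X" "y \<in> G F'"
      using G_finite_support[OF y] by (elim exE conjE)
    show ?thesis
    proof (cases "F \<union> F' = {}")
      case True
      \<comment> \<open>With empty supports there is no largest index, but \<open>x\<close> lies in
        \<open>G {}\<close> and is itself the interpolant.\<close>
      then have "x \<in> G {}" using F by simp
      then have "x \<in> G (\<Gamma> \<inter> \<Delta>)" using G_mono[of "{}" "\<Gamma> \<inter> \<Delta>"] by auto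
      then show ?thesis using le by blast
    next
      case False
      then obtain m where m: "m \<in> F \<union> F'" "F \<union> F' \<subseteq> under W m"
        using finite_index_max[OF finite_UnI[OF F(1) F'(1)]] F(2) F'(2) X by blast
      then have "m \<in> X" "x \<in> G (\<Gamma> \<inter> under W m)" "y \<in> G (\<Delta> \<inter> under W m)"
        using F F' G_mono[of F "\<Gamma> \<inter> under W m"] G_mono[of F' "\<Delta> \<inter> under W m"] by auto
      then show ?thesis using P le by blast
    qed
  qed
  have under: "\<exists>d\<in>G (\<Gamma> \<inter> \<Delta>). x \<le> d \<and> d \<le> y"
    if "\<alpha> \<in> Field W" "x \<in> G (\<Gamma> \<inter> under W \<alpha>)" "y \<in> G (\<Delta> \<inter> under W \<alpha>)" "x \<le> y" for \<alpha> x y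
    using that
  proof (induction \<alpha> arbitrary: x y rule: wf_induct_index)
    case (1 \<alpha>)
    have "underS W \<alpha> \<subseteq> Field W" by (auto simp: underS_def Field_def)
    then have "\<exists>d\<in>G (\<Gamma> \<inter> \<Delta>). x \<le> d \<and> d \<le> y"
      if "x \<in> G (\<Gamma> \<inter> underS W \<alpha>)" "y \<in> G (\<Delta> \<inter> underS W \<alpha>)" "x \<le> y" for x y
      using reduce[OF "1.IH" _ that] by simp
    then show ?case
      by (rule interpolation_step[OF "1.hyps" \<Gamma> \<Delta> _ "1.prems"])
  qed
  have "\<Gamma> \<inter> Field W = \<Gamma>" "\<Delta> \<inter> Field W = \<Delta>"
    using \<Gamma> \<Delta> by (auto simp: closed_index_def)
  then show ?thesis
    using reduce[OF under _ _ _ le, of "Field W"] x y by simp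
qed

lemma closed_index_UN:
  assumes "\<And>j. j \<in> J \<Longrightarrow> closed_index (\<Gamma> j)"
  shows "closed_index (\<Union>j\<in>J. \<Gamma> j)"
  unfolding closed_index_def
proof (intro conjI ballI)
  show "(\<Union>j\<in>J. \<Gamma> j) \<subseteq> Field W" using assms by (auto simp: closed_index_def)
  fix \<alpha> assume "\<alpha> \<in> (\<Union>j\<in>J. \<Gamma> j)"
  then obtain j where j: "j \<in> J" "\<alpha> \<in> \<Gamma> j" by auto
  then have "G (underS W \<alpha>) \<inter> S \<alpha> \<subseteq> G (\<Gamma> j \<inter> underS W \<alpha>)"
    using assms by (auto simp: closed_index_def)
  also have "\<dots> \<subseteq> G ((\<Union>j\<in>J. \<Gamma> j) \<inter> underS W \<alpha>)"
    using j by (intro G_mono) auto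
  finally show "G (underS W \<alpha>) \<inter> S \<alpha> \<subseteq> G ((\<Union>j\<in>J. \<Gamma> j) \<inter> underS W \<alpha>)" .
qed

text \<open>The gluing algebra of \<open>S \<alpha>\<close> with the tower below is countable, and
  each of its elements has a finite support below \<alpha>. The induction gives countable closed
  sets around these countably many indices; their union together with \<alpha> is closed.\<close>

lemma countable_closed_index:
  assumes "\<alpha> \<in> Field W"
  shows "\<exists>\<Gamma>. countable \<Gamma> \<and> closed_index \<Gamma> \<and> \<alpha> \<in> \<Gamma>"
  using assms
proof (induction \<alpha> rule: wf_induct_index)
  case (1 \<alpha>)
  obtain \<Gamma> where \<Gamma>: "\<And>\<beta>. \<beta> \<in> underS W \<alpha> \<Longrightarrow> countable (\<Gamma> \<beta>) \<and> closed_index (\<Gamma> \<beta>) \<and> \<beta> \<in> \<Gamma> \<beta>"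
    using "1.IH" by metis
  let ?R = "G (underS W \<alpha>) \<inter> S \<alpha>"
  have "\<forall>r\<in>?R. \<exists>F. finite F \<and> F \<subseteq> underS W \<alpha> \<and> r \<in> G F"
    using G_finite_support by simp
  then obtain F where F: "\<And>r. r \<in> ?R \<Longrightarrow> finite (F r) \<and> F r \<subseteq> underS W \<alpha> \<and> r \<in> G (F r)"
    by metis
  define J where "J = (\<Union>r\<in>?R. F r)"
  have J: "countable J" "J \<subseteq> underS W \<alpha>"
    unfolding J_def using F countable_S[OF "1.hyps"]
    by (auto intro!: countable_UN intro: countable_finite)
  define \<Delta> where "\<Delta> = (\<Union>\<beta>\<in>J. \<Gamma> \<beta>)"
  have \<Delta>: "closed_index \<Delta>" "countable \<Delta>" "J \<subseteq> \<Delta>"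
    unfolding \<Delta>_def using J \<Gamma> by (auto intro!: closed_index_UN countable_UN)
  have "closed_index (insert \<alpha> \<Delta>)"
    unfolding closed_index_def
  proof (intro conjI ballI)
    show "insert \<alpha> \<Delta> \<subseteq> Field W" using \<Delta> "1.hyps" by (auto simp: closed_index_def)
    fix \<gamma> assume "\<gamma> \<in> insert \<alpha> \<Delta>"
    then consider "\<gamma> = \<alpha>" | "\<gamma> \<in> \<Delta>" by auto
    then show "G (underS W \<gamma>) \<inter> S \<gamma> \<subseteq> G (insert \<alpha> \<Delta> \<inter> underS W \<gamma>)"
    proof cases
      case 1
      show ?thesis
      proof
        fix r assume "r \<in> G (underS W \<gamma>) \<inter> S \<gamma>"
        then have "F r \<subseteq> insert \<alpha> \<Delta> \<inter> underS W \<gamma>" "r \<in> G (F r)"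
          using F[of r] \<Delta>(3) 1 by (auto simp: J_def)
        then show "r \<in> G (insert \<alpha> \<Delta> \<inter> underS W \<gamma>)" using G_mono by blast
      qed
    next
      case 2
      then have "G (underS W \<gamma>) \<inter> S \<gamma> \<subseteq> G (\<Delta> \<inter> underS W \<gamma>)"
        using \<Delta>(1) by (auto simp: closed_index_def)
      also have "\<dots> \<subseteq> G (insert \<alpha> \<Delta> \<inter> underS W \<gamma>)" by (intro G_mono) auto
      finally show ?thesis .
    qed
  qed
  then show ?case using \<Delta>(2) by blast
qed

text \<open>The map sends \<open>x\<close> to \<open>G (\<Gamma> x)\<close> for a countable closed
  set \<open>\<Gamma> x\<close> supporting \<open>x\<close>; interpolants over
  \<open>\<Gamma> x \<inter> \<Gamma> y\<close> lie in both values.\<close>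

lemma freese_nation_map:
  assumes total: "G (Field W) = UNIV"
  shows "\<exists>g :: 'a \<Rightarrow> 'a set. (\<forall>x. countable (g x)) \<and>
    (\<forall>x y. x \<le> y \<longrightarrow> (\<exists>d\<in>g x \<inter> g y. x \<le> d \<and> d \<le> y))"
proof -
  have "\<exists>\<Gamma>. countable \<Gamma> \<and> closed_index \<Gamma> \<and> x \<in> G \<Gamma>" for x
  proof -
    obtain F where F: "finite F" "F \<subseteq> Field W" "x \<in> G F"
      using G_finite_support[of x "Field W"] total by auto
    obtain \<Gamma> where \<Gamma>: "\<And>\<beta>. \<beta> \<in> F \<Longrightarrow> countable (\<Gamma> \<beta>) \<and> closed_index (\<Gamma> \<beta>) \<and> \<beta> \<in> \<Gamma> \<beta>"
      using countable_closed_index F(2) by (metis subsetD)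
    have "F \<subseteq> (\<Union>\<beta>\<in>F. \<Gamma> \<beta>)" using \<Gamma> by auto
    moreover have "countable (\<Union>\<beta>\<in>F. \<Gamma> \<beta>)"
      using \<Gamma> countable_finite[OF F(1)] by (intro countable_UN) auto
    ultimately show ?thesis
      using closed_index_UN[of F \<Gamma>] \<Gamma> F(3) G_mono by blast
  qed
  then obtain \<Gamma> where \<Gamma>: "\<And>x. countable (\<Gamma> x)" "\<And>x. closed_index (\<Gamma> x)" "\<And>x. x \<in> G (\<Gamma> x)"
    by metis
  show ?thesis
  proof (intro exI[of _ "\<lambda>x. G (\<Gamma> x)"] conjI allI impI)
    fix x
    have "\<Gamma> x \<subseteq> Field W" using \<Gamma>(2) by (auto simp: closed_index_def)
    then show "countable (G (\<Gamma> x))"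
      unfolding G_def using \<Gamma>(1) countable_S by (intro countable_generated countable_UN) auto
  next
    fix x y :: 'a assume "x \<le> y"
    then obtain d where "d \<in> G (\<Gamma> x \<inter> \<Gamma> y)" "x \<le> d" "d \<le> y"
      using interpolation[OF \<Gamma>(2) \<Gamma>(2) \<Gamma>(3) \<Gamma>(3)] by metis
    moreover have "G (\<Gamma> x \<inter> \<Gamma> y) \<subseteq> G (\<Gamma> x) \<inter> G (\<Gamma> y)"
      using G_mono[of "\<Gamma> x \<inter> \<Gamma> y"] by simp
    ultimately show "\<exists>d\<in>G (\<Gamma> x) \<inter> G (\<Gamma> y). x \<le> d \<and> d \<le> y"
      by (intro bexI[of _ d]) auto
  qed
qed

end

text \<open>The countable algebras \<open>S \<alpha>\<close> of the push-outs form a commuting tower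
  once each stage \<open>B \<alpha>\<close> is known to be generated by the \<open>S \<beta>\<close>
  below \<alpha>. This is a well-founded induction through the least, successor and limit
  cases.\<close>

lemma tightly_sigma_filtered_freese_nation:
  assumes "tightly_sigma_filtered TYPE('i) TYPE('a::boolean_algebra)"
  shows "\<exists>g :: 'a \<Rightarrow> 'a set. (\<forall>x. countable (g x)) \<and>
    (\<forall>x y. x \<le> y \<longrightarrow> (\<exists>d\<in>g x \<inter> g y. x \<le> d \<and> d \<le> y))"
proof -
  obtain W :: "'i rel" and B :: "'i \<Rightarrow> 'a set" where "tightly_sigma_filtration W B"
    using assms unfolding tightly_sigma_filtered_def by blast
  then have W: "Well_order W"
    and mono: "\<And>\<alpha> \<beta>. (\<alpha>, \<beta>) \<in> W \<Longrightarrow> B \<alpha> \<subseteq> B \<beta>"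
    and least: "\<And>\<alpha>. is_least W \<alpha> \<Longrightarrow> B \<alpha> = {bot, top}"
    and total: "(\<Union>\<alpha>\<in>Field W. B \<alpha>) = UNIV"
    and limit: "\<And>\<alpha>. is_limit W \<alpha> \<Longrightarrow> B \<alpha> = (\<Union>\<beta>\<in>underS W \<alpha>. B \<beta>)"
    and push: "\<forall>\<alpha>\<in>Field W. \<exists>R S. countable R \<and> countable S \<and> subalgebra R \<and> subalgebra S \<and>
        pushout R (B \<alpha>) S (next_stage W B \<alpha>)"
    unfolding tightly_sigma_filtration_def by blast+
  obtain R S where S: "\<And>\<alpha>. \<alpha> \<in> Field W \<Longrightarrow> countable (S \<alpha>) \<and> subalgebra (S \<alpha>) \<and>
      pushout (R \<alpha>) (B \<alpha>) (S \<alpha>) (next_stage W B \<alpha>)"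
    using push by metis
  have order: "Total W" "trans W" "Refl W" "antisym W" "wf (W - Id)"
    using W by (auto simp: well_order_on_def linear_order_on_def
        partial_order_on_def preorder_on_def)
  have succ: "next_stage W B \<beta> = B \<alpha>" if "is_succ W \<beta> \<alpha>" for \<alpha> \<beta>
  proof -
    have "(THE \<gamma>. is_succ W \<beta> \<gamma>) = \<alpha>"
      using that order(4) unfolding is_succ_def by (intro the_equality) (auto dest: antisymD)
    then show ?thesis using that unfolding next_stage_def by auto
  qed
  have gen: "\<alpha> \<in> Field W \<longrightarrow> B \<alpha> = generated (\<Union>\<beta>\<in>underS W \<alpha>. S \<beta>)" for \<alpha>
    using order(5)
  proof (induction \<alpha>)
    case (less \<alpha>)
    show ?case
    proof
      assume \<alpha>: "\<alpha> \<in> Field W"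
      have IH: "B \<beta> = generated (\<Union>\<gamma>\<in>underS W \<beta>. S \<gamma>)" if "\<beta> \<in> underS W \<alpha>" for \<beta>
        using less that by (auto simp: underS_def Field_def)
      have underS_mono: "underS W \<beta> \<subseteq> underS W \<alpha>" if "\<beta> \<in> underS W \<alpha>" for \<beta>
        using that order(2,4) by (auto simp: underS_def dest: antisymD transD)
      have S_sub: "S \<beta> \<subseteq> B \<alpha>" if \<beta>\<alpha>: "\<beta> \<in> underS W \<alpha>" for \<beta>
      proof -
        have \<beta>: "\<beta> \<in> Field W" using \<beta>\<alpha> by (auto simp: underS_def Field_def)
        have 1: "S \<beta> \<subseteq> next_stage W B \<beta>"
          using S[OF \<beta>] unfolding pushout_def by blast
        \<comment> \<open>The immediate successor of \<beta> is the least index above it, which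
          exists since \<alpha> is above \<beta>. Hence \<open>next_stage\<close> at \<beta> is a
          genuine stage and not its default \<open>UNIV\<close>.\<close>
        obtain \<gamma> where \<gamma>: "(\<beta>, \<gamma>) \<in> W - Id"
          "\<And>\<delta>. (\<delta>, \<gamma>) \<in> W - Id \<Longrightarrow> \<delta> \<notin> {\<delta>. (\<beta>, \<delta>) \<in> W - Id}"
        proof (rule wfE_min[OF order(5)])
          show "\<alpha> \<in> {\<delta>. (\<beta>, \<delta>) \<in> W - Id}" using \<beta>\<alpha> by (auto simp: underS_def)
        qed auto
        have least\<gamma>: "(\<gamma>, \<delta>) \<in> W" if "\<beta> \<in> underS W \<delta>" for \<delta>
        proof -
          have "\<gamma> \<in> Field W" "\<delta> \<in> Field W" "(\<beta>, \<delta>) \<in> W - Id"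
            using \<gamma> that by (auto simp: underS_def Field_def)
          then have "(\<gamma>, \<gamma>) \<in> W" "\<gamma> \<noteq> \<delta> \<Longrightarrow> (\<gamma>, \<delta>) \<in> W \<or> (\<delta>, \<gamma>) \<in> W"
            "\<gamma> \<noteq> \<delta> \<Longrightarrow> (\<delta>, \<gamma>) \<notin> W"
            using \<gamma>(2)[of \<delta>] order(1,3) by (auto simp: total_on_def refl_on_def)
          then show ?thesis by (cases "\<gamma> = \<delta>") auto
        qed
        have "is_succ W \<beta> \<gamma>"
          using \<gamma>(1) least\<gamma> unfolding is_succ_def by (auto simp: underS_def Field_def)
        moreover have "B \<gamma> \<subseteq> B \<alpha>" using mono least\<gamma>[OF \<beta>\<alpha>] by blast
        ultimately show ?thesis using 1 succ by auto
      qed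
      consider "is_least W \<alpha>" | \<beta> where "is_succ W \<beta> \<alpha>" | "is_limit W \<alpha>"
        using \<alpha> unfolding is_limit_def by blast
      then have "B \<alpha> \<subseteq> generated (\<Union>\<beta>\<in>underS W \<alpha>. S \<beta>)"
      proof cases
        case 1
        then show ?thesis using least generated_closed(1,2) by auto
      next
        case (2 \<beta>)
        then have \<beta>: "\<beta> \<in> underS W \<alpha>" "\<beta> \<in> Field W"
          unfolding is_succ_def by (auto simp: underS_def Field_def)
        have "B \<alpha> = generated (B \<beta> \<union> S \<beta>)"
          using S[OF \<beta>(2)] succ[OF 2] unfolding pushout_def by simp
        also have "\<dots> \<subseteq> generated (\<Union>\<beta>\<in>underS W \<alpha>. S \<beta>)"
        proof (rule generated_idem)
          have "B \<beta> \<subseteq> generated (\<Union>\<beta>\<in>underS W \<alpha>. S \<beta>)"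
            unfolding IH[OF \<beta>(1)] using underS_mono[OF \<beta>(1)] by (intro generated_mono) auto
          moreover have "S \<beta> \<subseteq> generated (\<Union>\<beta>\<in>underS W \<alpha>. S \<beta>)"
            by (rule order_trans[OF UN_upper[OF \<beta>(1)] generated_superset])
          ultimately show "B \<beta> \<union> S \<beta> \<subseteq> generated (\<Union>\<beta>\<in>underS W \<alpha>. S \<beta>)" by (rule Un_least)
        qed
        finally show ?thesis .
      next
        case 3
        have "B \<beta> \<subseteq> generated (\<Union>\<beta>\<in>underS W \<alpha>. S \<beta>)" if "\<beta> \<in> underS W \<alpha>" for \<beta>
          unfolding IH[OF that] using underS_mono[OF that] by (intro generated_mono) auto
        then show ?thesis unfolding limit[OF 3] by (rule UN_least)
      qed
      moreover have "subalgebra (B \<alpha>)"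
        using \<open>tightly_sigma_filtration W B\<close> \<alpha> unfolding tightly_sigma_filtration_def by blast
      then have "generated (\<Union>\<beta>\<in>underS W \<alpha>. S \<beta>) \<subseteq> B \<alpha>"
        using S_sub by (intro generated_least) auto
      ultimately show "B \<alpha> = generated (\<Union>\<beta>\<in>underS W \<alpha>. S \<beta>)" by blast
    qed
  qed
  interpret commuting_tower W S
    using W S gen by unfold_locales (auto simp: pushout_def)
  have "B \<alpha> \<subseteq> G (Field W)" if "\<alpha> \<in> Field W" for \<alpha>
    unfolding G_def gen[rule_format, OF that]
    by (intro generated_mono) (auto simp: underS_def Field_def)
  then have "G (Field W) = UNIV" using total by blast
  then show ?thesis by (rule freese_nation_map)
qed


section \<open>Embeddings of \<open>\<ell>\<^sub>\<infinity>\<close> into \<open>C(K)\<close>\<close>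

lemma ultrafilterD:
  assumes "U \<in> ultrafilters"
  shows "top \<in> U" "bot \<notin> U" "a \<in> U \<Longrightarrow> a \<le> b \<Longrightarrow> b \<in> U"
    "a \<in> U \<Longrightarrow> b \<in> U \<Longrightarrow> inf a b \<in> U" "a \<in> U \<or> - a \<in> U"
  using assms by (simp_all add: ultrafilters_def)

text \<open>Zorn's lemma gives a maximal proper ideal containing \<open>I\<close>, whose complement
  is an ultrafilter. This takes the place of compactness of the Stone space: an ideal contains
  \<open>top\<close> as soon as every ultrafilter meets it.\<close>

lemma ultrafilter_avoiding_ideal:
  fixes I :: "'a::boolean_algebra set"
  assumes bot: "bot \<in> I" and top: "top \<notin> I"
    and sup: "\<And>a b. a \<in> I \<Longrightarrow> b \<in> I \<Longrightarrow> sup a b \<in> I"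
    and down: "\<And>a b. b \<in> I \<Longrightarrow> a \<le> b \<Longrightarrow> a \<in> I"
  shows "\<exists>U\<in>ultrafilters. U \<inter> I = {}"
proof -
  define Ideals where "Ideals = {J. I \<subseteq> J \<and> top \<notin> J \<and> (\<forall>a\<in>J. \<forall>b\<in>J. sup a b \<in> J) \<and>
    (\<forall>b\<in>J. \<forall>a. a \<le> b \<longrightarrow> a \<in> J)}"
  have "\<exists>M\<in>Ideals. \<forall>X\<in>Ideals. M \<subseteq> X \<longrightarrow> X = M"
  proof (rule subset_Zorn_nonempty)
    have "I \<in> Ideals" using assms unfolding Ideals_def by blast
    then show "Ideals \<noteq> {}" by blast
  next
    fix C assume C: "C \<noteq> {}" "subset.chain Ideals C"
    have CI: "J \<in> Ideals" if "J \<in> C" for J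
      using C(2) that unfolding subset.chain_def by blast
    have "\<exists>J\<in>C. a \<in> J \<and> b \<in> J" if ab: "a \<in> \<Union>C" "b \<in> \<Union>C" for a b
    proof -
      obtain J J' where J: "J \<in> C" "J' \<in> C" "a \<in> J" "b \<in> J'" using ab by auto
      then have "J \<subseteq> J' \<or> J' \<subseteq> J"
        using C(2) by (auto simp: subset_chain_def)
      then show ?thesis using J by blast
    qed
    note common = this
    have "sup a b \<in> \<Union>C" if ab: "a \<in> \<Union>C" "b \<in> \<Union>C" for a b
    proof -
      obtain J where "J \<in> C" "a \<in> J" "b \<in> J" using common[OF ab] by auto
      then show ?thesis using CI[of J] by (intro UnionI[of J]) (simp_all add: Ideals_def)
    qed
    moreover have "a \<in> \<Union>C" if ab: "b \<in> \<Union>C" "a \<le> b" for a b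
    proof -
      obtain J where "J \<in> C" "b \<in> J" using ab(1) by auto
      then show ?thesis using CI[of J] ab(2) by (intro UnionI[of J]) (auto simp: Ideals_def)
    qed
    moreover have "I \<subseteq> \<Union>C"
    proof -
      obtain J where "J \<in> C" using C(1) by auto
      then show ?thesis using CI[of J] by (auto simp: Ideals_def)
    qed
    moreover have "top \<notin> \<Union>C" using CI by (auto simp: Ideals_def)
    ultimately show "\<Union>C \<in> Ideals" unfolding Ideals_def by simp
  qed
  then obtain M where M: "M \<in> Ideals" and max: "\<And>X. X \<in> Ideals \<Longrightarrow> M \<subseteq> X \<Longrightarrow> X = M" by blast
  have MI: "I \<subseteq> M" "top \<notin> M" "\<And>a b. a \<in> M \<Longrightarrow> b \<in> M \<Longrightarrow> sup a b \<in> M"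
    "\<And>a b. b \<in> M \<Longrightarrow> a \<le> b \<Longrightarrow> a \<in> M"
    using M unfolding Ideals_def by auto
  have botM: "bot \<in> M" using bot MI(1) by blast
  have compl: "- a \<in> M" if a: "a \<notin> M" for a
  proof -
    \<comment> \<open>\<open>X\<close> is the ideal generated by \<open>M\<close> and
      \<open>a\<close>. By maximality of \<open>M\<close> it is not proper, so
      \<open>top \<le> sup a j\<close> for some \<open>j\<close> in \<open>M\<close>, and then
      \<open>- a \<le> j\<close>.\<close>
    define X where "X = {x. \<exists>j\<in>M. x \<le> sup a j}"
    have "j \<in> X" if "j \<in> M" for j
      using that unfolding X_def by (auto intro: bexI[of _ j])
    then have "M \<subseteq> X" by blast
    have "a \<in> X" using botM unfolding X_def by (auto intro: bexI[of _ bot])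
    then have "X \<notin> Ideals" using max[OF _ \<open>M \<subseteq> X\<close>] a by blast
    moreover have "sup x y \<in> X" if xy: "x \<in> X" "y \<in> X" for x y
    proof -
      obtain j k where jk: "j \<in> M" "k \<in> M" "x \<le> sup a j" "y \<le> sup a k"
        using xy by (auto simp: X_def)
      then have "sup x y \<le> sup a (sup j k)"
        using sup_mono[OF jk(3,4)] by (simp add: ac_simps)
      then show ?thesis using MI(3)[OF jk(1,2)] unfolding X_def by (intro CollectI bexI)
    qed
    moreover have "x \<in> X" if "y \<in> X" "x \<le> y" for x y
      using that unfolding X_def by (auto intro: order_trans)
    ultimately have "top \<in> X"
      using MI(1) \<open>M \<subseteq> X\<close> unfolding Ideals_def by auto
    then obtain j where j: "j \<in> M" "top \<le> sup a j" by (auto simp: X_def)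
    then have "- a \<le> j" by (metis compl_le_swap2 double_compl shunt1 sup_commute top.extremum_uniqueI inf_top_left)
    then show ?thesis using MI(4) j(1) by blast
  qed
  have not_both: "\<not> (a \<in> M \<and> - a \<in> M)" for a
    using MI(2) MI(3)[of a "- a"] by auto
  have "- M \<in> ultrafilters"
    unfolding ultrafilters_def
  proof (intro CollectI conjI ballI allI impI)
    fix a b assume "a \<in> - M" "b \<in> - M"
    then have "- a \<in> M" "- b \<in> M" using compl by auto
    then have "- inf a b \<in> M" using MI(3) by simp
    then show "inf a b \<in> - M" using not_both by blast
  qed (use MI botM not_both in auto)
  moreover have "- M \<inter> I = {}" using MI(1) by blast
  ultimately show ?thesis by blast
qed

text \<open>The ideal below \<open>sup (- a) b\<close> is proper when \<open>a \<le> b\<close>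
  fails; an ultrafilter avoiding it contains \<open>a\<close> but not \<open>b\<close>.\<close>

lemma le_if_ultrafilters:
  fixes a b :: "'a::boolean_algebra"
  assumes sub: "\<And>U. U \<in> ultrafilters \<Longrightarrow> a \<in> U \<Longrightarrow> b \<in> U"
  shows "a \<le> b"
proof (rule ccontr)
  assume neg: "\<not> a \<le> b"
  let ?I = "{x. x \<le> sup (- a) b}"
  have "\<exists>U\<in>ultrafilters. U \<inter> ?I = {}"
  proof (rule ultrafilter_avoiding_ideal)
    show "top \<notin> ?I" using neg by (auto simp: top_unique sup_shunt)
  qed (auto intro: order_trans)
  then obtain U where U: "U \<in> ultrafilters" "U \<inter> ?I = {}" by blast
  then have "b \<notin> U" "- a \<notin> U" by auto
  moreover have "a \<in> U \<or> - a \<in> U" by (rule ultrafilterD(5)[OF U(1)])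
  ultimately show False using sub U(1) by blast
qed

lemma topspace_stone_space: "topspace stone_space = ultrafilters"
proof -
  have "ultrafilters = {U \<in> ultrafilters. top \<in> U}"
    using ultrafilterD(1) by auto
  then have "ultrafilters \<in> {{U \<in> ultrafilters. a \<in> U} | a. True}"
    by (intro CollectI exI[of _ top] conjI TrueI)
  then show ?thesis
    unfolding stone_space_def topology_generated_by_topspace by (intro equalityI Union_upper) auto
qed

text \<open>Finite intersections of generating sets are again of that form through
  \<open>inf\<close>, so the generating sets are already a basis.\<close>

lemma stone_space_basis:
  assumes "openin stone_space Z" "U \<in> Z"
  shows "\<exists>a\<in>U. \<forall>V\<in>ultrafilters. a \<in> V \<longrightarrow> V \<in> Z"
proof -
  have "generate_topology_on {{U \<in> ultrafilters. a \<in> U} | a. True} Z"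
    using assms(1) by (simp add: stone_space_def openin_topology_generated_by_iff)
  then have "Z \<subseteq> ultrafilters \<and> (\<forall>U\<in>Z. \<exists>a\<in>U. \<forall>V\<in>ultrafilters. a \<in> V \<longrightarrow> V \<in> Z)"
  proof (induction rule: generate_topology_on.induct)
    case (Int P Q)
    have "\<exists>a\<in>U. \<forall>V\<in>ultrafilters. a \<in> V \<longrightarrow> V \<in> P \<inter> Q" if U: "U \<in> P \<inter> Q" for U
    proof -
      obtain a where a: "a \<in> U" "\<forall>V\<in>ultrafilters. a \<in> V \<longrightarrow> V \<in> P"
        using Int.IH(1) U by auto
      obtain b where b: "b \<in> U" "\<forall>V\<in>ultrafilters. b \<in> V \<longrightarrow> V \<in> Q"
        using Int.IH(2) U by auto
      have "U \<in> ultrafilters" using Int.IH(1) U by auto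
      then have "inf a b \<in> U" using a(1) b(1) by (rule ultrafilterD(4))
      moreover have "V \<in> P \<inter> Q" if "V \<in> ultrafilters" "inf a b \<in> V" for V
        using a(2) b(2) ultrafilterD(3)[OF that] that(1) by simp
      ultimately show ?thesis by auto
    qed
    then show ?case using Int.IH(1) by auto
  next
    case (UN K)
    have "\<exists>a\<in>U. \<forall>V\<in>ultrafilters. a \<in> V \<longrightarrow> V \<in> \<Union>K" if U: "U \<in> \<Union>K" for U
    proof -
      obtain k where k: "k \<in> K" "U \<in> k" using U by auto
      then obtain a where "a \<in> U" "\<forall>V\<in>ultrafilters. a \<in> V \<longrightarrow> V \<in> k" using UN.IH[of k] by auto
      then show ?thesis using k(1) by auto
    qed
    then show ?case using UN.IH by auto
  next
    case (Basis s)
    then show ?case by auto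
  qed auto
  then show ?thesis using assms(2) by simp
qed

section \<open>Continuous functions on the Stone space\<close>

lemma CK_stone_neighbourhood:
  assumes f: "f \<in> CK stone_space" and U: "U \<in> ultrafilters" and G: "open G" "f U \<in> G"
  shows "\<exists>a\<in>U. \<forall>V\<in>ultrafilters. a \<in> V \<longrightarrow> f V \<in> G"
proof -
  have "openin stone_space {V \<in> topspace stone_space. f V \<in> G}"
    using f G(1) by (intro openin_continuous_map_preimage[of _ euclideanreal]) (auto simp: CK_def)
  from stone_space_basis[OF this, of U] show ?thesis
    using U G(2) by (auto simp: topspace_stone_space)
qed

lemma ultrafilter_prime:
  assumes "U \<in> ultrafilters" "sup a b \<in> U"
  shows "a \<in> U \<or> b \<in> U"
proof (rule ccontr)
  assume "\<not> ?thesis"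
  then have "- a \<in> U" "- b \<in> U" using ultrafilterD(5)[OF assms(1)] by auto
  then have "inf (sup a b) (inf (- a) (- b)) \<in> U"
    using ultrafilterD(4)[OF assms(1)] assms(2) by simp
  moreover have "inf (sup a b) (inf (- a) (- b)) = bot"
    by (metis compl_sup inf_compl_bot)
  ultimately show False using ultrafilterD(2)[OF assms(1)] by simp
qed

text \<open>The elements on whose clopen sets \<open>f\<close> is bounded form an ideal. By
  continuity every ultrafilter meets it, so it contains \<open>top\<close>.\<close>

lemma CK_stone_bounded:
  assumes f: "f \<in> CK stone_space"
  shows "\<exists>M. \<forall>U\<in>ultrafilters. \<bar>f U\<bar> \<le> M"
proof (rule ccontr)
  assume neg: "\<not> ?thesis"
  let ?I = "{a. \<exists>M. \<forall>U\<in>ultrafilters. a \<in> U \<longrightarrow> \<bar>f U\<bar> \<le> M}"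
  have "\<exists>U\<in>ultrafilters. U \<inter> ?I = {}"
  proof (rule ultrafilter_avoiding_ideal)
    show "bot \<in> ?I" using ultrafilterD(2) by blast
    show "top \<notin> ?I" using neg ultrafilterD(1) by blast
    show "a \<in> ?I" if "b \<in> ?I" "a \<le> b" for a b
      using that ultrafilterD(3) by blast
    show "sup a b \<in> ?I" if ab: "a \<in> ?I" "b \<in> ?I" for a b
    proof -
      obtain M M' where "\<forall>U\<in>ultrafilters. a \<in> U \<longrightarrow> \<bar>f U\<bar> \<le> M" "\<forall>U\<in>ultrafilters. b \<in> U \<longrightarrow> \<bar>f U\<bar> \<le> M'"
        using ab by auto
      then have "\<forall>U\<in>ultrafilters. sup a b \<in> U \<longrightarrow> \<bar>f U\<bar> \<le> max M M'"
        using ultrafilter_prime by (metis max.coboundedI1 max.coboundedI2)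
      then show ?thesis by (intro CollectI exI)
    qed
  qed
  then obtain U where U: "U \<in> ultrafilters" "U \<inter> ?I = {}" by blast
  obtain a where "a \<in> U" "\<forall>V\<in>ultrafilters. a \<in> V \<longrightarrow> f V \<in> ball (f U) 1"
    using CK_stone_neighbourhood[OF f U(1), of "ball (f U) 1"] by auto
  then have "\<forall>V\<in>ultrafilters. a \<in> V \<longrightarrow> \<bar>f V\<bar> \<le> \<bar>f U\<bar> + 1"
    by (fastforce simp: dist_real_def)
  then have "a \<in> ?I" by blast
  then show False using U(2) \<open>a \<in> U\<close> by blast
qed

text \<open>The ideal consists of the elements covered by a clopen set where \<open>f\<close>
  exceeds \<open>s\<close> and one where \<open>f\<close> is below \<open>t\<close>. Since
  \<open>s < t\<close>, every point has a neighbourhood of one of the two kinds, so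
  \<open>top\<close> is covered, and the first covering set separates.\<close>

lemma CK_stone_separation:
  fixes f :: "'a::boolean_algebra set \<Rightarrow> real"
  assumes f: "f \<in> CK stone_space" and st: "s < t"
  shows "\<exists>a. \<forall>U\<in>ultrafilters. (t \<le> f U \<longrightarrow> a \<in> U) \<and> (a \<in> U \<longrightarrow> s < f U)"
proof -
  let ?P = "\<lambda>a. \<forall>U\<in>ultrafilters. a \<in> U \<longrightarrow> s < f U"
  let ?Q = "\<lambda>b. \<forall>U\<in>ultrafilters. b \<in> U \<longrightarrow> f U < t"
  let ?I = "{x. \<exists>a b. x \<le> sup a b \<and> ?P a \<and> ?Q b}"
  have botPQ: "?P bot" "?Q bot" using ultrafilterD(2) by blast+
  have "top \<in> ?I"
  proof (rule ccontr)
    assume top: "top \<notin> ?I"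
    have "\<exists>U\<in>ultrafilters. U \<inter> ?I = {}"
    proof (rule ultrafilter_avoiding_ideal[OF _ top])
      show "bot \<in> ?I" using botPQ by (intro CollectI exI[of _ bot]) auto
      show "x \<in> ?I" if y: "y \<in> ?I" "x \<le> y" for x y
      proof -
        obtain a b where "y \<le> sup a b" "?P a" "?Q b" using y(1) by (elim CollectE exE conjE)
        then show ?thesis using y(2) by (intro CollectI exI[of _ a] exI[of _ b]) auto
      qed
      show "sup x y \<in> ?I" if xy: "x \<in> ?I" "y \<in> ?I" for x y
      proof -
        obtain a b where ab: "x \<le> sup a b" "?P a" "?Q b" using xy(1) by (elim CollectE exE conjE)
        obtain a' b' where ab': "y \<le> sup a' b'" "?P a'" "?Q b'" using xy(2) by (elim CollectE exE conjE)
        have "?P (sup a a')" "?Q (sup b b')"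
          using ab ab' ultrafilter_prime by metis+
        moreover have "sup x y \<le> sup (sup a a') (sup b b')"
          using sup_mono[OF ab(1) ab'(1)] by (simp add: ac_simps)
        ultimately show ?thesis by (intro CollectI exI[of _ "sup a a'"] exI[of _ "sup b b'"] conjI)
      qed
    qed
    then obtain U where U: "U \<in> ultrafilters" "U \<inter> ?I = {}" by (elim bexE)
    have PQ: "a \<in> ?I" if "?P a \<or> ?Q a" for a
      using that
    proof
      assume "?P a"
      then show ?thesis using botPQ by (intro CollectI exI[of _ a] exI[of _ bot]) auto
    next
      assume "?Q a"
      then show ?thesis using botPQ by (intro CollectI exI[of _ bot] exI[of _ a]) auto
    qed
    show False
    proof (cases "s < f U")
      case True
      then obtain a where "a \<in> U" "?P a"
        using CK_stone_neighbourhood[OF f U(1), of "{s<..}"] by auto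
      then show False using PQ[of a] U(2) by auto
    next
      case False
      then obtain a where "a \<in> U" "?Q a"
        using CK_stone_neighbourhood[OF f U(1), of "{..<t}"] st by auto
      then show False using PQ[of a] U(2) by auto
    qed
  qed
  then obtain a b where ab: "top \<le> sup a b" "?P a" "?Q b" by (elim CollectE exE conjE)
  have "a \<in> U" if "U \<in> ultrafilters" "t \<le> f U" for U
  proof -
    have "sup a b \<in> U" using ultrafilterD(3)[OF that(1) ultrafilterD(1)[OF that(1)] ab(1)] .
    then have "a \<in> U \<or> b \<in> U" by (rule ultrafilter_prime[OF that(1)])
    then show ?thesis using ab(3) that by fastforce
  qed
  then show ?thesis using ab(2) by (intro exI[of _ a]) simp
qed

text \<open>Partington's argument that \<open>\<ell>\<^sub>\<infinity>\<close> is not distortable. Let \<open>w A\<close> be the norm of \<open>T\<close> on the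
  vectors supported in \<open>A\<close>, and choose \<open>A0\<close> with \<open>w A0\<close> close to the infimum \<open>m\<close> over infinite sets.
  Splitting \<open>A0\<close> into infinitely many infinite pieces and taking an almost norming unit vector in
  each piece, \<open>\<phi> A\<close> is the image of the sum of the vectors indexed by \<open>A\<close>.\<close>

lemma linfty_almost_isometric_blocks:
  assumes "linfty_embeds_in_CK (stone_space :: 'a::boolean_algebra set topology)"
  shows "\<exists>(m::real) \<phi> (p :: nat \<Rightarrow> 'a set). 0 < m \<and> (\<forall>A. \<phi> A \<in> CK stone_space) \<and>
    (\<forall>n. p n \<in> ultrafilters \<and> 99 / 100 * m < \<phi> {n} (p n)) \<and>
    (\<forall>A B. \<forall>q\<in>ultrafilters. A \<inter> B = {} \<longrightarrow>
      \<phi> (A \<union> B) q = \<phi> A q + \<phi> B q \<and> \<phi> A q - \<phi> B q \<le> 101 / 100 * m)"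
proof -
  let ?K = "stone_space :: 'a set topology"
  obtain T :: "(nat \<Rightarrow> real) \<Rightarrow> 'a set \<Rightarrow> real" and c C where
    T0: "\<forall>x\<in>linfty. T x \<in> CK ?K"
      "\<forall>x\<in>linfty. \<forall>y\<in>linfty. \<forall>p\<in>topspace ?K. T (\<lambda>n. x n + y n) p = T x p + T y p"
      "\<forall>x\<in>linfty. \<forall>a. \<forall>p\<in>topspace ?K. T (\<lambda>n. a * x n) p = a * T x p"
      "0 < c" "\<forall>x\<in>linfty. c * linfty_norm x \<le> CK_norm ?K (T x) \<and> CK_norm ?K (T x) \<le> C * linfty_norm x"
    using assms unfolding linfty_embeds_in_CK_def by (elim exE conjE)
  have T: "T x \<in> CK ?K" and lower: "c * linfty_norm x \<le> CK_norm ?K (T x)"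
    and upper: "CK_norm ?K (T x) \<le> C * linfty_norm x" if "x \<in> linfty" for x
    using T0 that by simp_all
  have add: "T (\<lambda>n. x n + y n) p = T x p + T y p"
    if "x \<in> linfty" "y \<in> linfty" "p \<in> ultrafilters" for x y p
    using T0(2) that by (simp add: topspace_stone_space)
  have scale: "T (\<lambda>n. a * x n) p = a * T x p" if "x \<in> linfty" "p \<in> ultrafilters" for x a p
    using T0(3) that by (simp add: topspace_stone_space)
  note c = T0(4)
  define N where "N = (\<lambda>x. CK_norm ?K (T x))"
  define unit_ball where "unit_ball = (\<lambda>A. {x :: nat \<Rightarrow> real. (\<forall>n. \<bar>x n\<bar> \<le> 1) \<and> (\<forall>n. n \<notin> A \<longrightarrow> x n = 0)})"
  have ball_linfty: "x \<in> linfty" if "x \<in> unit_ball A" for x A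
    using that unfolding unit_ball_def linfty_def bounded_iff by auto
  have ball_norm: "0 \<le> linfty_norm x" "linfty_norm x \<le> 1" if "x \<in> unit_ball A" for x A
  proof -
    have le: "\<bar>x n\<bar> \<le> 1" for n using that by (simp add: unit_ball_def)
    then have bdd: "bdd_above (range (\<lambda>n. \<bar>x n\<bar>))" by (intro bdd_aboveI2)
    show "linfty_norm x \<le> 1" unfolding linfty_norm_def by (rule cSUP_least) (simp_all add: le)
    have "\<bar>x 0\<bar> \<le> linfty_norm x" unfolding linfty_norm_def using bdd by (rule cSUP_upper2) auto
    then show "0 \<le> linfty_norm x" by linarith
  qed
  have N_le: "N x \<le> \<bar>C\<bar>" if "x \<in> unit_ball A" for x A
  proof -
    have "N x \<le> C * linfty_norm x" unfolding N_def by (rule upper[OF ball_linfty[OF that]])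
    also have "\<dots> \<le> \<bar>C\<bar> * linfty_norm x" using ball_norm(1)[OF that] by (intro mult_right_mono) auto
    also have "\<dots> \<le> \<bar>C\<bar> * 1" using ball_norm(2)[OF that] by (intro mult_left_mono) auto
    finally show ?thesis by simp
  qed
  have singleton: "(\<lambda>i. if i = n then 1 else 0) \<in> unit_ball A" "c \<le> N (\<lambda>i. if i = n then 1 else 0)"
    if "n \<in> A" for n A
  proof -
    let ?e = "\<lambda>i. if i = n then 1 else 0 :: real"
    show ball: "?e \<in> unit_ball A" using that by (auto simp: unit_ball_def)
    have "\<bar>?e n\<bar> \<le> linfty_norm ?e"
      unfolding linfty_norm_def by (rule cSUP_upper[OF UNIV_I bdd_aboveI[of _ 1]]) auto
    then have "linfty_norm ?e = 1" using ball_norm(2)[OF ball] by simp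
    then show "c \<le> N ?e" using lower[OF ball_linfty[OF ball]] by (simp add: N_def)
  qed
  \<comment> \<open>Over the empty space \<open>CK_norm\<close> is the supremum of the empty set, the same junk value for all \<open>x\<close>.\<close>
  have nonempty: "(ultrafilters :: 'a set set) \<noteq> {}"
  proof
    assume empty: "(ultrafilters :: 'a set set) = {}"
    have N_const: "N x = N y" for x y
      unfolding N_def CK_norm_def topspace_stone_space empty by simp
    have zero: "(\<lambda>_. 0) \<in> linfty" by (simp add: linfty_def)
    have "N (\<lambda>_. 0) \<le> 0" using upper[OF zero] by (simp add: N_def linfty_norm_def)
    moreover have "0 < N (\<lambda>_. 0)" using singleton(2)[OF UNIV_I] c N_const by (metis less_le_trans)
    ultimately show False by simp
  qed
  \<comment> \<open>Real suprema carry information only for bounded sets; boundedness comes from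
    compactness, via \<open>CK_stone_bounded\<close>.\<close>
  have bdd: "bdd_above ((\<lambda>p. \<bar>T x p\<bar>) ` ultrafilters)" if "x \<in> linfty" for x
    using CK_stone_bounded[OF T[OF that]] by (auto intro: bdd_aboveI)
  have T_le_N: "\<bar>T x p\<bar> \<le> N x" if "x \<in> linfty" "p \<in> ultrafilters" for x p
    unfolding N_def CK_norm_def topspace_stone_space using bdd[OF that(1)] that(2) by (rule cSUP_upper2) simp
  define w where "w = (\<lambda>A. SUP x\<in>unit_ball A. N x)"
  define m where "m = (INF A\<in>{A. infinite A}. w A)"
  have zero_ball: "(\<lambda>_. 0) \<in> unit_ball A" for A by (simp add: unit_ball_def)
  have w_bdd: "bdd_above (N ` unit_ball A)" for A
    by (rule bdd_aboveI2) (rule N_le)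
  have w_ge: "c \<le> w A" if A: "infinite A" for A
  proof -
    obtain n where "n \<in> A" using infinite_imp_nonempty[OF A] by auto
    then show ?thesis
      unfolding w_def using singleton by (intro cSUP_upper2[OF w_bdd]) auto
  qed
  \<comment> \<open>The lower constant \<open>c\<close> of the embedding, tested on coordinate
    vectors, keeps \<open>m\<close> away from 0.\<close>
  have m_ge: "c \<le> m" unfolding m_def using w_ge infinite_UNIV_nat by (intro cINF_greatest) auto
  then have m: "0 < m" using c by simp
  have m_le: "m \<le> w A" if "infinite A" for A
    unfolding m_def using that w_ge by (intro cINF_lower bdd_belowI2[of _ c]) auto
  have "(INF A\<in>{A. infinite A}. w A) < 101 / 100 * m" using m by (simp add: m_def[symmetric])
  then obtain A0 where A0: "infinite A0" "w A0 < 101 / 100 * m"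
    using cInf_lessD[of "w ` {A. infinite A}" "101 / 100 * m"] infinite_UNIV_nat by auto
  have peak: "\<exists>y\<in>unit_ball A. \<exists>p\<in>ultrafilters. 99 / 100 * m < T y p" if A: "infinite A" for A
  proof -
    have "99 / 100 * m < w A" using m m_le[OF A] by simp
    then obtain y where y: "y \<in> unit_ball A" "99 / 100 * m < N y"
      unfolding w_def using less_cSUP_iff[OF _ w_bdd] zero_ball by blast
    then obtain p where p: "p \<in> ultrafilters" "99 / 100 * m < \<bar>T y p\<bar>"
      unfolding N_def CK_norm_def topspace_stone_space
      using less_cSUP_iff[OF nonempty bdd[OF ball_linfty]] by blast
    show ?thesis
    proof (cases "0 \<le> T y p")
      case True
      then show ?thesis using y p by auto
    next
      case False
      \<comment> \<open>The ball is symmetric, so a large negative value becomes a large positive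
        one after a change of sign.\<close>
      have "(\<lambda>n. - 1 * y n) \<in> unit_ball A" using y(1) by (simp add: unit_ball_def)
      moreover have "T (\<lambda>n. - 1 * y n) p = - 1 * T y p" by (rule scale[OF ball_linfty[OF y(1)] p(1)])
      ultimately show ?thesis using p False by force
    qed
  qed
  \<comment> \<open>\<open>\<kappa> n\<close> is the number of the block containing
    \<open>n\<close>: the position of \<open>n\<close> in the enumeration of \<open>A0\<close> is
    read as a pair, and its first component is taken. The free second component makes each block
    infinite.\<close>
  define \<kappa> where "\<kappa> = (\<lambda>n. fst (prod_decode (inv (enumerate A0) n)))"
  define D where "D = (\<lambda>k. {n \<in> A0. \<kappa> n = k})"
  have D: "infinite (D k)" for k
  proof -
    have inj: "inj (enumerate A0)" using strict_mono_enumerate[OF A0(1)] by (rule strict_mono_imp_inj_on)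
    have "range (\<lambda>j. enumerate A0 (prod_encode (k, j))) \<subseteq> D k"
      using enumerate_in_set[OF A0(1)] by (auto simp: D_def \<kappa>_def inv_f_f[OF inj])
    moreover have "inj (\<lambda>j. enumerate A0 (prod_encode (k, j)))"
      by (intro injI) (auto dest!: injD[OF inj] simp: prod_encode_eq)
    ultimately show ?thesis by (meson finite_imageD finite_subset infinite_UNIV_nat)
  qed
  have "\<forall>k. \<exists>y p. y \<in> unit_ball (D k) \<and> p \<in> ultrafilters \<and> 99 / 100 * m < T y p"
    using peak[OF D] by blast
  then obtain y p where y: "\<And>k. y k \<in> unit_ball (D k)" and p: "\<And>k. p k \<in> ultrafilters"
    "\<And>k. 99 / 100 * m < T (y k) (p k)"
    by metis
  \<comment> \<open>The blocks are disjoint, so the vectors \<open>y k\<close> are summed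
    coordinatewise, with no question of convergence, and all coordinates stay between -1 and
    1.\<close>
  define z where "z = (\<lambda>A n. if n \<in> A0 \<and> \<kappa> n \<in> A then y (\<kappa> n) n else 0)"
  have y_le: "\<bar>y k n\<bar> \<le> 1" for k n using y[of k] by (simp add: unit_ball_def)
  have z_ball: "z A \<in> unit_ball A0" for A using y_le by (auto simp: unit_ball_def z_def)
  note z_linfty = ball_linfty[OF z_ball]
  have z_single: "z {k} = y k" for k
    using y[of k] by (auto simp: z_def unit_ball_def D_def fun_eq_iff)
  show ?thesis
  proof (intro exI[of _ m] exI[of _ "\<lambda>A. T (z A)"] exI[of _ p] conjI allI ballI impI)
    fix A B :: "nat set" and q :: "'a set" assume q: "q \<in> ultrafilters" and AB: "A \<inter> B = {}"
    have "z (A \<union> B) = (\<lambda>n. z A n + z B n)" using AB by (auto simp: z_def fun_eq_iff)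
    then show "T (z (A \<union> B)) q = T (z A) q + T (z B) q" using add[OF z_linfty z_linfty q] by simp
    have minus: "(\<lambda>n. - 1 * z B n) \<in> linfty"
      by (rule ball_linfty[of _ A0]) (use z_ball in \<open>simp add: unit_ball_def\<close>)
    \<comment> \<open>Disjoint \<open>A\<close> and \<open>B\<close> give vectors with disjoint
      supports, so the difference is again in the ball over \<open>A0\<close>, and the choice of
      \<open>A0\<close> bounds its image.\<close>
    have ball: "(\<lambda>n. z A n + - 1 * z B n) \<in> unit_ball A0"
      using AB y_le by (auto simp: unit_ball_def z_def)
    have "T (z A) q - T (z B) q = T (\<lambda>n. z A n + - 1 * z B n) q"
      using add[OF z_linfty minus q] scale[OF z_linfty q, of "- 1"] by simp
    also have "\<dots> \<le> N (\<lambda>n. z A n + - 1 * z B n)"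
      using T_le_N[OF ball_linfty[OF ball] q] by linarith
    also have "\<dots> \<le> w A0" unfolding w_def by (rule cSUP_upper[OF ball w_bdd])
    finally show "T (z A) q - T (z B) q \<le> 101 / 100 * m" using A0(2) by simp
  qed (use m T z_linfty p z_single in auto)
qed

text \<open>The clopen sets \<open>b A\<close> and \<open>c A\<close> approximate superlevel sets of
  \<open>\<phi> A\<close>, at a higher and a lower level. Since \<open>grow\<close> loses a little,
  inclusions lead from the higher level to the lower one, which is why two families occur.\<close>

lemma linfty_embedding_separating_families:
  assumes "linfty_embeds_in_CK (stone_space :: 'a::boolean_algebra set topology)"
  shows "\<exists>(b :: nat set \<Rightarrow> 'a) c p. (\<forall>n. p n \<in> ultrafilters) \<and> (\<forall>A A'. A \<subseteq> A' \<longrightarrow> b A \<le> c A') \<and>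
    (\<forall>A. \<forall>n\<in>A. b A \<in> p n) \<and> (\<forall>A n. n \<notin> A \<longrightarrow> c A \<notin> p n)"
proof -
  obtain m :: real and \<phi> and p :: "nat \<Rightarrow> 'a set" where m: "0 < m"
    and \<phi>: "\<And>A. \<phi> A \<in> CK stone_space"
    and p: "\<And>n. p n \<in> ultrafilters" "\<And>n. 99 / 100 * m < \<phi> {n} (p n)"
    and add: "\<And>A B q. q \<in> ultrafilters \<Longrightarrow> A \<inter> B = {} \<Longrightarrow> \<phi> (A \<union> B) q = \<phi> A q + \<phi> B q"
    and diff: "\<And>A B q. q \<in> ultrafilters \<Longrightarrow> A \<inter> B = {} \<Longrightarrow> \<phi> A q - \<phi> B q \<le> 101 / 100 * m"
    using linfty_almost_isometric_blocks[OF assms] by metis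
  have empty: "\<phi> {} q = 0" if "q \<in> ultrafilters" for q
    using add[OF that, of "{}" "{}"] by simp
  have bound: "\<phi> A q \<le> 101 / 100 * m" if "q \<in> ultrafilters" for A q
    using diff[OF that, of A "{}"] empty[OF that] by simp
  \<comment> \<open>This replaces monotonicity of \<open>\<phi>\<close>: where \<open>\<phi> A\<close> nearly attains the norm, there is no room
    left for a negative contribution of \<open>A' - A\<close>.\<close>
  have grow: "2 * \<phi> A q - 101 / 100 * m \<le> \<phi> A' q" if "q \<in> ultrafilters" "A \<subseteq> A'" for A A' q
  proof -
    have "A \<union> (A' - A) = A'" using that(2) by blast
    then have "\<phi> A' q = \<phi> A q + \<phi> (A' - A) q" using add[OF that(1), of A "A' - A"] by simp
    then show ?thesis using diff[OF that(1), of A "A' - A"] by simp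
  qed
  have inside: "97 / 100 * m \<le> \<phi> A (p n)" if "n \<in> A" for A n
    using grow[OF p(1), of "{n}" A n] p(2)[of n] that by simp
  have outside: "\<phi> A (p n) \<le> 2 / 100 * m" if "n \<notin> A" for A n
  proof -
    have "\<phi> ({n} \<union> A) (p n) = \<phi> {n} (p n) + \<phi> A (p n)" using that by (intro add[OF p(1)]) auto
    then show ?thesis using bound[OF p(1), of "{n} \<union> A" n] p(2)[of n] by simp
  qed
  \<comment> \<open>In units of \<open>m\<close>: the value at \<open>p n\<close> for
    \<open>n \<in> A\<close> is at least 2 * 0.99 - 1.01 = 0.97. Where \<open>\<phi> A\<close>
    exceeds 0.9, \<open>\<phi> A'\<close> exceeds 2 * 0.9 - 1.01 = 0.79, the upper level for
    \<open>c\<close>; the lower level 0.5 is above 1.01 - 0.99 = 0.02, the bound at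
    \<open>p n\<close> for \<open>n\<close> outside \<open>A\<close>.\<close>
  have "\<forall>A. \<exists>a. \<forall>U\<in>ultrafilters. (97 / 100 * m \<le> \<phi> A U \<longrightarrow> a \<in> U) \<and> (a \<in> U \<longrightarrow> 9 / 10 * m < \<phi> A U)"
    using m by (intro allI CK_stone_separation[OF \<phi>]) simp
  then obtain b where b: "\<And>A U. U \<in> ultrafilters \<Longrightarrow> 97 / 100 * m \<le> \<phi> A U \<Longrightarrow> b A \<in> U"
    "\<And>A U. U \<in> ultrafilters \<Longrightarrow> b A \<in> U \<Longrightarrow> 9 / 10 * m < \<phi> A U" by metis
  have "\<forall>A. \<exists>a. \<forall>U\<in>ultrafilters. (79 / 100 * m \<le> \<phi> A U \<longrightarrow> a \<in> U) \<and> (a \<in> U \<longrightarrow> 1 / 2 * m < \<phi> A U)"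
    using m by (intro allI CK_stone_separation[OF \<phi>]) simp
  then obtain c where c: "\<And>A U. U \<in> ultrafilters \<Longrightarrow> 79 / 100 * m \<le> \<phi> A U \<Longrightarrow> c A \<in> U"
    "\<And>A U. U \<in> ultrafilters \<Longrightarrow> c A \<in> U \<Longrightarrow> 1 / 2 * m < \<phi> A U" by metis
  have "b A \<le> c A'" if "A \<subseteq> A'" for A A'
  proof (rule le_if_ultrafilters)
    fix U assume U: "U \<in> ultrafilters" "b A \<in> U"
    show "c A' \<in> U"
      using b(2)[OF U] grow[OF U(1) that] by (intro c(1)[OF U(1)]) simp
  qed
  moreover have "b A \<in> p n" if "n \<in> A" for A n
    by (rule b(1)[OF p(1) inside[OF that]])
  moreover have "c A \<notin> p n" if "n \<notin> A" for A n
  proof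
    assume "c A \<in> p n"
    then have "1 / 2 * m < \<phi> A (p n)" by (rule c(2)[OF p(1)])
    then show False using outside[OF that] m by simp
  qed
  ultimately show ?thesis using p(1) by (intro exI[of _ b] exI[of _ c] exI[of _ p]) simp
qed


section \<open>Chains of length \<open>\<omega>\<^sub>2\<close>\<close>

context includes cardinal_syntax
begin

lemma countable_iff_ordLeq_nat: "countable A \<longleftrightarrow> |A| \<le>o |UNIV :: nat set|"
  unfolding countable_def card_of_ordLeq[symmetric] by auto

text \<open>This gives access to cardinal arithmetic. If \<open>|A|\<close> exceeded the successor
  cardinal of omega, that cardinal would be isomorphic to a proper initial segment of
  \<open>V\<close>, which is countable. Conversely, initial segments of the cardinal order on
  \<open>A\<close> are smaller than \<open>|A|\<close>, hence countable.\<close>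

lemma le_aleph1_iff_ordLeq: "le_aleph1 A \<longleftrightarrow> |A| \<le>o cardSuc |UNIV :: nat set|"
proof
  assume "le_aleph1 A"
  then obtain V where V: "Well_order V" "Field V = A" "\<forall>x\<in>A. countable (underS V x)"
    unfolding le_aleph1_def by (elim exE conjE)
  show "|A| \<le>o cardSuc |UNIV :: nat set|"
  proof (rule ccontr)
    assume neg: "\<not> ?thesis"
    have "cardSuc |UNIV :: nat set| <o |A| \<or> |A| \<le>o cardSuc |UNIV :: nat set|"
      by (rule ordLess_or_ordLeq[OF cardSuc_Well_order[OF card_of_Card_order] card_of_Well_order])
    then have "cardSuc |UNIV :: nat set| <o |A|" using neg by simp
    also have "|A| \<le>o V"
      using card_of_least[of A V] V by simp
    finally obtain a where a: "a \<in> Field V" "cardSuc |UNIV :: nat set| =o Restr V (underS V a)"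
      unfolding ordLess_iff_ordIso_Restr[OF V(1) cardSuc_Well_order[OF card_of_Card_order]] by (elim bexE)
    have "cardSuc |UNIV :: nat set| \<le>o |Field (cardSuc |UNIV :: nat set| )|"
      unfolding Card_order_iff_ordLeq_card_of[symmetric] by (rule cardSuc_Card_order[OF card_of_Card_order])
    also have "|Field (cardSuc |UNIV :: nat set| )| \<le>o |Field (Restr V (underS V a))|"
      by (rule card_of_mono2[OF ordIso_imp_ordLeq[OF a(2)]])
    also have "|Field (Restr V (underS V a))| \<le>o |underS V a|"
      by (rule card_of_mono1) (auto simp: Field_def)
    also have "|underS V a| \<le>o |UNIV :: nat set|"
      unfolding countable_iff_ordLeq_nat[symmetric] using V(2,3) a(1) by simp
    finally show False
      using not_ordLess_ordLeq[OF cardSuc_greater[OF card_of_Card_order]] by (rule notE[rotated])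
  qed
next
  assume le: "|A| \<le>o cardSuc |UNIV :: nat set|"
  show "le_aleph1 A"
    unfolding le_aleph1_def
  proof (intro exI[of _ "|A|"] conjI ballI)
    fix x assume "x \<in> A"
    then have "|underS |A| x| <o |A|"
      by (intro card_of_underS[OF card_of_Card_order]) (simp add: Field_card_of)
    then have "|underS |A| x| <o cardSuc |UNIV :: nat set|"
      using le by (rule ordLess_ordLeq_trans)
    then show "countable (underS |A| x)"
      unfolding countable_iff_ordLeq_nat cardSuc_ordLeq_ordLess[OF card_of_Card_order card_of_Card_order] .
  qed (simp_all add: Field_card_of card_of_well_order_on)
qed

lemma countable_imp_le_aleph1: "countable A \<Longrightarrow> le_aleph1 A"
  unfolding le_aleph1_iff_ordLeq countable_iff_ordLeq_nat
  by (rule ordLeq_transitive[OF _ cardSuc_ordLeq[OF card_of_Card_order]])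

lemma le_aleph1_mono: "A \<subseteq> B \<Longrightarrow> le_aleph1 B \<Longrightarrow> le_aleph1 A"
  unfolding le_aleph1_iff_ordLeq by (rule ordLeq_transitive[OF card_of_mono1])

lemma le_aleph1_image: "le_aleph1 A \<Longrightarrow> le_aleph1 (f ` A)"
  unfolding le_aleph1_iff_ordLeq by (rule ordLeq_transitive[OF card_of_image])

text \<open>The square of aleph_1 is aleph_1. The cardinal is replaced by its field because
  \<open>card_of_UNION_ordLeq_infinite\<close> bounds by the cardinality of a set.\<close>

lemma le_aleph1_UN:
  assumes "le_aleph1 I" "\<And>i. i \<in> I \<Longrightarrow> le_aleph1 (A i)"
  shows "le_aleph1 (\<Union>i\<in>I. A i)"
proof -
  let ?a = "cardSuc |UNIV :: nat set|"
  have Card: "Card_order ?a" by (rule cardSuc_Card_order[OF card_of_Card_order])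
  have iso: "|Field ?a| =o ?a" by (rule card_of_Field_ordIso[OF Card])
  have "infinite (Field ?a)"
    using cardSuc_finite[OF card_of_Card_order, of "UNIV :: nat set"] by (simp add: Field_card_of)
  moreover have "|I| \<le>o |Field ?a|" "\<forall>i\<in>I. |A i| \<le>o |Field ?a|"
    using assms iso unfolding le_aleph1_iff_ordLeq
    by (meson ordIso_symmetric ordLeq_ordIso_trans)+
  ultimately have "|\<Union>i\<in>I. A i| \<le>o |Field ?a|" by (rule card_of_UNION_ordLeq_infinite)
  then show ?thesis
    unfolding le_aleph1_iff_ordLeq using iso by (rule ordLeq_ordIso_trans)
qed

end

section \<open>Orders of type omega_2\<close>

context
  fixes W :: "'c rel"
  assumes W: "omega2_order W"
begin

lemma omega2_order_facts: "Total W" "trans W" "Refl W" "antisym W" "wf (W - Id)"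
  using W by (auto simp: omega2_order_def well_order_on_def linear_order_on_def
      partial_order_on_def preorder_on_def)

text \<open>Regularity of omega_2: if \<open>X\<close> were unbounded, the field would be a union of
  at most aleph_1 initial segments, each of size at most aleph_1.\<close>

lemma omega2_bounded:
  assumes X: "X \<subseteq> Field W" "le_aleph1 X"
  shows "\<exists>y\<in>Field W. X \<subseteq> underS W y"
proof (rule ccontr)
  assume neg: "\<not> ?thesis"
  have "Field W \<subseteq> (\<Union>x\<in>X. insert x (underS W x))"
  proof
    fix y assume y: "y \<in> Field W"
    then obtain x where x: "x \<in> X" "x \<notin> underS W y" using neg by blast
    then have "x \<in> Field W" using X by blast
    then have "x = y \<or> (y, x) \<in> W"
      using x y omega2_order_facts(1) by (auto simp: total_on_def underS_def)
    then have "y \<in> insert x (underS W x)" by (auto simp: underS_def)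
    then show "y \<in> (\<Union>x\<in>X. insert x (underS W x))" using x(1) by blast
  qed
  moreover have "le_aleph1 (insert x (underS W x))" if "x \<in> X" for x
  proof -
    have "le_aleph1 (\<Union>i\<in>{False, True}. if i then {x} else underS W x)"
    proof (rule le_aleph1_UN)
      fix i
      show "le_aleph1 (if i then {x} else underS W x)"
        using W that X countable_imp_le_aleph1[of "{x}"] by (auto simp: omega2_order_def)
    qed (simp add: countable_imp_le_aleph1)
    then show ?thesis by simp
  qed
  ultimately have "le_aleph1 (Field W)"
    using le_aleph1_mono[OF _ le_aleph1_UN[OF X(2)]] by metis
  then show False using W by (simp add: omega2_order_def)
qed

text \<open>The sequence \<open>e\<close> is built by recursion along an initial segment of type
  omega_1: before each step only countably many countable sets \<open>K (e j)\<close> have been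
  produced, so they have a common strict bound.\<close>

lemma omega2_closed_sequence:
  assumes K: "\<And>x. x \<in> Field W \<Longrightarrow> countable (K x) \<and> K x \<subseteq> Field W"
  obtains I e \<delta> where "uncountable I" "I \<subseteq> Field W" "\<And>i. i \<in> I \<Longrightarrow> countable (underS W i)"
    "\<And>i. i \<in> I \<Longrightarrow> e i \<in> Field W"
    "\<And>i j. i \<in> I \<Longrightarrow> j \<in> underS W i \<Longrightarrow> K (e j) \<subseteq> underS W (e i)"
    "\<delta> \<in> Field W" "\<And>i. i \<in> I \<Longrightarrow> e i \<in> underS W \<delta>"
proof -
  note order = omega2_order_facts
  \<comment> \<open>Otherwise \<open>W\<close> itself would witness that its field has at most
    aleph_1 elements.\<close>
  have "\<exists>x\<in>Field W. uncountable (underS W x)"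
  proof (rule ccontr)
    assume "\<not> ?thesis"
    moreover have "Well_order W" using W by (simp add: omega2_order_def)
    ultimately have "le_aleph1 (Field W)"
      unfolding le_aleph1_def by (intro exI[of _ W]) simp
    then show False using W by (simp add: omega2_order_def)
  qed
  then obtain x1 where "x1 \<in> {x \<in> Field W. uncountable (underS W x)}" by blast
  then obtain x0 where x0: "x0 \<in> Field W" "uncountable (underS W x0)"
    and min: "\<And>y. (y, x0) \<in> W - Id \<Longrightarrow> y \<notin> {x \<in> Field W. uncountable (underS W x)}"
    by (rule wfE_min[OF order(5)]) auto
  \<comment> \<open>\<open>I\<close> is the initial segment of type \<open>\<omega>\<^sub>1\<close>.\<close>
  define I where "I = underS W x0"
  have I: "I \<subseteq> Field W" "\<And>i. i \<in> I \<Longrightarrow> countable (underS W i)"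
    using min by (auto simp: I_def underS_def Field_def)
  have I_down: "j \<in> I" if "i \<in> I" "j \<in> underS W i" for i j
    using that order(2,4) by (auto simp: I_def underS_def dest: transD antisymD)
  \<comment> \<open>Outside \<open>I\<close> the requirement is vacuous, so the recursion can run
    along all of \<open>W\<close>.\<close>
  define P where "P = (\<lambda>(e :: 'c \<Rightarrow> 'c) i y. i \<in> I \<longrightarrow> y \<in> Field W \<and>
    (\<forall>j\<in>underS W i. K (e j) \<subseteq> underS W y))"
  have "\<exists>e. \<forall>i. P e i (e i)"
  proof (rule dependent_wf_choice[OF order(5)])
    fix e e' :: "'c \<Rightarrow> 'c" and i r assume eq: "\<And>z. (z, i) \<in> W - Id \<Longrightarrow> e z = e' z"
    have "e j = e' j" if "j \<in> underS W i" for j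
      using eq that by (auto simp: underS_def)
    then show "P e i r = P e' i r"
      unfolding P_def by auto
  next
    fix i and e :: "'c \<Rightarrow> 'c" assume prev: "\<And>j. (j, i) \<in> W - Id \<Longrightarrow> P e j (e j)"
    show "\<exists>r. P e i r"
    proof (cases "i \<in> I")
      case True
      have e: "e j \<in> Field W" if "j \<in> underS W i" for j
        using prev[of j] I_down[OF True that] that by (auto simp: P_def underS_def)
      have "countable (\<Union>j\<in>underS W i. K (e j))" "(\<Union>j\<in>underS W i. K (e j)) \<subseteq> Field W"
        using e K I(2)[OF True] by auto
      then obtain y where "y \<in> Field W" "(\<Union>j\<in>underS W i. K (e j)) \<subseteq> underS W y"
        using omega2_bounded[OF _ countable_imp_le_aleph1] by metis
      then show ?thesis by (auto simp: P_def)
    qed (simp add: P_def)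
  qed
  then obtain e where e: "\<And>i. P e i (e i)" by metis
  have "e ` I \<subseteq> Field W" using e by (auto simp: P_def)
  moreover have "le_aleph1 (e ` I)"
    using W x0(1) unfolding I_def by (intro le_aleph1_image) (simp add: omega2_order_def)
  ultimately obtain \<delta> where "\<delta> \<in> Field W" "e ` I \<subseteq> underS W \<delta>"
    using omega2_bounded by metis
  moreover have "uncountable I" using x0(2) by (simp add: I_def)
  ultimately show thesis
    using I e by (intro that[of I e \<delta>]) (auto simp: P_def)
qed

end

text \<open>The contradiction comes from two indices, \<open>i0\<close> below \<open>i\<close>,
  sharing an interpolant \<open>v\<close>: through \<open>i0\<close> the bad index
  \<open>\<beta> v\<close> is caught by \<open>K (e i0)\<close> and so lies below
  \<open>e i\<close>, while \<open>f (e i)\<close> is contained in \<open>E v\<close>.\<close>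

lemma omega2_chain_no_interpolation:
  fixes b c :: "nat set \<Rightarrow> 'a::boolean_algebra" and p :: "nat \<Rightarrow> 'a set" and W :: "'c rel"
  assumes W: "omega2_order W"
    and f: "\<And>x y. x \<in> Field W \<Longrightarrow> y \<in> Field W \<Longrightarrow> x \<in> underS W y \<Longrightarrow> pfin_less (f x) (f y)"
    and g: "\<And>x::'a. countable (g x :: 'a set)" "\<And>x y :: 'a. x \<le> y \<Longrightarrow> \<exists>d\<in>g x \<inter> g y. x \<le> d \<and> d \<le> y"
    and p: "\<And>n. p n \<in> ultrafilters"
    and le: "\<And>A A'. A \<subseteq> A' \<Longrightarrow> b A \<le> c A'"
    and b: "\<And>n A. n \<in> A \<Longrightarrow> b A \<in> p n"
    and c: "\<And>n A. n \<notin> A \<Longrightarrow> c A \<notin> p n"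
  shows False
proof -
  define E where "E = (\<lambda>d. {n. d \<in> p n})"
  \<comment> \<open>Every witness that \<open>E d\<close> does not almost contain the whole chain is caught by \<open>K\<close>, so the
    sequence \<open>e\<close> overtakes it; this closure replaces an elementary submodel.\<close>
  define \<beta> where "\<beta> = (\<lambda>d. SOME x. x \<in> Field W \<and> infinite (f x - E d))"
  have \<beta>: "\<beta> d \<in> Field W" "infinite (f (\<beta> d) - E d)" if "\<exists>x\<in>Field W. infinite (f x - E d)" for d
    using someI_ex[of "\<lambda>x. x \<in> Field W \<and> infinite (f x - E d)"] that by (auto simp: \<beta>_def)
  define K where "K = (\<lambda>x. \<beta> ` {d \<in> g (b (f x)). \<exists>x\<in>Field W. infinite (f x - E d)})"
  have K: "countable (K x) \<and> K x \<subseteq> Field W" for x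
    using g(1) \<beta>(1) unfolding K_def by (auto intro!: countable_image intro: countable_subset)
  obtain I e \<delta> where I: "uncountable I" "I \<subseteq> Field W" "\<And>i. i \<in> I \<Longrightarrow> countable (underS W i)"
    and e: "\<And>i. i \<in> I \<Longrightarrow> e i \<in> Field W"
      "\<And>i j. i \<in> I \<Longrightarrow> j \<in> underS W i \<Longrightarrow> K (e j) \<subseteq> underS W (e i)"
    and \<delta>: "\<delta> \<in> Field W" "\<And>i. i \<in> I \<Longrightarrow> e i \<in> underS W \<delta>"
    using omega2_closed_sequence[OF W, of K] K by metis
  have "\<exists>d F. finite F \<and> d \<in> g (b (f (e i))) \<and> d \<in> g (c (f \<delta> \<union> F)) \<and>
      b (f (e i)) \<le> d \<and> d \<le> c (f \<delta> \<union> F)" if i: "i \<in> I" for i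
  proof -
    \<comment> \<open>Almost inclusion becomes true inclusion, as \<open>le\<close> demands, once
      the finite difference is added to \<open>f \<delta>\<close>.\<close>
    define F where "F = f (e i) - f \<delta>"
    have "finite F"
      using f[OF e(1)[OF i] \<delta>(1) \<delta>(2)[OF i]] by (simp add: pfin_less_def F_def)
    moreover have "b (f (e i)) \<le> c (f \<delta> \<union> F)" by (rule le) (auto simp: F_def)
    then obtain d where "d \<in> g (b (f (e i))) \<inter> g (c (f \<delta> \<union> F))" "b (f (e i)) \<le> d" "d \<le> c (f \<delta> \<union> F)"
      using g(2) by blast
    ultimately show ?thesis by blast
  qed
  then obtain d F where F: "\<And>i. i \<in> I \<Longrightarrow> finite (F i)"
    and d: "\<And>i. i \<in> I \<Longrightarrow> d i \<in> g (b (f (e i)))" "\<And>i. i \<in> I \<Longrightarrow> d i \<in> g (c (f \<delta> \<union> F i))"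
      "\<And>i. i \<in> I \<Longrightarrow> b (f (e i)) \<le> d i" "\<And>i. i \<in> I \<Longrightarrow> d i \<le> c (f \<delta> \<union> F i)"
    by metis
  \<comment> \<open>There are only countably many finite sets of natural numbers, so only countably
    many interpolants occur, and one of them is shared by uncountably many indices.\<close>
  have "d ` I \<subseteq> (\<Union>F\<in>{F. finite F}. g (c (f \<delta> \<union> F)))" using F d(2) by auto
  moreover have "countable (\<Union>F\<in>{F. finite F}. g (c (f \<delta> \<union> F)))"
    by (intro countable_UN countable_Collect_finite g(1))
  ultimately have "countable (d ` I)" by (rule countable_subset)
  have "\<exists>v\<in>d ` I. uncountable {i \<in> I. d i = v}"
  proof (rule ccontr)
    assume "\<not> ?thesis"
    then have "countable (\<Union>v\<in>d ` I. {i \<in> I. d i = v})"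
      using \<open>countable (d ` I)\<close> by (intro countable_UN) auto
    moreover have "I = (\<Union>v\<in>d ` I. {i \<in> I. d i = v})" by auto
    ultimately show False using I(1) by simp
  qed
  then obtain v where v: "uncountable {i \<in> I. d i = v}" by blast
  then obtain i0 where i0: "i0 \<in> I" "d i0 = v"
    using not_finite_existsD uncountable_infinite by blast
  have "countable (insert i0 (underS W i0))" using I(3) i0 by simp
  then have "\<not> {i \<in> I. d i = v} \<subseteq> insert i0 (underS W i0)"
    using v countable_subset by blast
  then obtain i where i: "i \<in> I" "d i = v" "i \<noteq> i0" "i \<notin> underS W i0" by blast
  then have "i0 \<in> underS W i"
    using I(2) i0(1) omega2_order_facts(1)[OF W] by (auto simp: total_on_def underS_def)
  have up: "y \<in> p n" if "x \<in> p n" "x \<le> y" for x y n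
    using p[of n] that unfolding ultrafilters_def by blast
  have lower: "f (e i) \<subseteq> E v"
    using up[OF b d(3)[OF i(1)]] i(2) by (auto simp: E_def)
  have upper: "E v \<subseteq> f \<delta> \<union> F i"
  proof
    fix n assume "n \<in> E v"
    then have "c (f \<delta> \<union> F i) \<in> p n" using up[OF _ d(4)[OF i(1)]] i(2) by (auto simp: E_def)
    then show "n \<in> f \<delta> \<union> F i" using c by blast
  qed
  \<comment> \<open>For an index \<open>y\<close> beyond \<delta>, infinitely many elements of
    \<open>f y\<close> lie outside \<open>f \<delta>\<close> and hence outside \<open>E v\<close>.
    So \<open>\<beta> v\<close> is a genuine witness and not an arbitrary value of
    \<open>SOME\<close>.\<close>
  have "le_aleph1 {\<delta>}" by (rule countable_imp_le_aleph1) simp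
  then obtain y where y: "y \<in> Field W" "\<delta> \<in> underS W y"
    using omega2_bounded[OF W, of "{\<delta>}"] \<delta>(1) by auto
  have "infinite (f y - f \<delta>)" using f[OF \<delta>(1) y] by (simp add: pfin_less_def)
  moreover have "f y - f \<delta> \<subseteq> (f y - E v) \<union> F i" using upper by blast
  ultimately have "infinite (f y - E v)"
    using F[OF i(1)] by (meson finite_Un finite_subset)
  then have ex: "\<exists>x\<in>Field W. infinite (f x - E v)" using y by blast
  then have "\<beta> v \<in> K (e i0)" using d(1)[OF i0(1)] i0(2) unfolding K_def by blast
  then have "\<beta> v \<in> underS W (e i)" using e(2)[OF i(1) \<open>i0 \<in> underS W i\<close>] by blast
  then have "finite (f (\<beta> v) - f (e i))"
    using f[OF \<beta>(1)[OF ex] e(1)[OF i(1)]] by (simp add: pfin_less_def)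
  then have "finite (f (\<beta> v) - E v)" using lower by (meson Diff_mono finite_subset order_refl)
  then show False using \<beta>(2)[OF ex] by blast
qed

theorem theorem5p2:
  assumes "tightly_sigma_filtered TYPE('i) TYPE('a::boolean_algebra)"
    and "has_omega2_chain TYPE('c)"
  shows "\<not> linfty_embeds_in_CK (stone_space :: 'a set topology)"
proof
  assume "linfty_embeds_in_CK (stone_space :: 'a set topology)"
  then obtain b c :: "nat set \<Rightarrow> 'a" and p where p: "\<forall>n. p n \<in> ultrafilters"
    and bc: "\<forall>A A'. A \<subseteq> A' \<longrightarrow> b A \<le> c A'" "\<forall>A. \<forall>n\<in>A. b A \<in> p n" "\<forall>A n. n \<notin> A \<longrightarrow> c A \<notin> p n"
    using linfty_embedding_separating_families by metis
  obtain g :: "'a \<Rightarrow> 'a set" where g: "\<forall>x. countable (g x)"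
    "\<forall>x y. x \<le> y \<longrightarrow> (\<exists>d\<in>g x \<inter> g y. x \<le> d \<and> d \<le> y)"
    using tightly_sigma_filtered_freese_nation[OF assms(1)] by (elim exE conjE)
  obtain W :: "'c rel" and f where W: "omega2_order W"
    and f: "\<forall>x\<in>Field W. \<forall>y\<in>Field W. x \<in> underS W y \<longrightarrow> pfin_less (f x) (f y)"
    using assms(2) unfolding has_omega2_chain_def by (elim exE conjE)
  show False
    by (rule omega2_chain_no_interpolation[OF W, of f g p b c]) (use f g p bc in simp_all)
qed

end
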